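(* Generic elements of $CE(S^1)$ are wicked; that is, there is a residual subset $\mathcal{R}$ of the topological space $CE(S^1)$ such that every $f\in\mathcal{R}$ is wicked.
   Context: $S^1=\mathbb{R}/\mathbb{Z}$. For an integer $k$ with $|k|\geq 2$, $E_k:S^1\to S^1$ is the map $x\mapsto kx \bmod 1$. $\mathrm{Homeo}_+(S^1)$ is the set of orientation-preserving homeomorphisms of $S^1$. Put $$CE_k(S^1)=\{hE_kh^{-1}:h\in\mathrm{Homeo}_+(S^1)\},\qquad CE(S^1)=\bigcup_{|k|\geq2}CE_k(S^1),$$ with the topology induced from the space $C^0(S^1)$ of continuous self-maps of $S^1$ with metric $d_{C^0}(f,g)=\sup_x d(f(x),g(x))$. A subset of a topological space $X$ is residual if it contains the intersection of a countable family of open and dense subsets of $X$. Let $m$ be Lebesgue measure on $S^1$ (a fixed volume probability). For a continuous map $f:S^1\to S^1$, $f_*\mu(A)=\mu(f^{-1}(A))$ denotes push-forward, and $\mathcal{M}_f(S^1)$ is the set of $f$-invariant Borel probability measures, with the weak* topology. Put $m_n=\frac1n\sum_{k=1}^n f_*^km$ for $n\geq1$. The map $f$ is wicked if $f$ is not uniquely ergodic and the sequence $(m_n)$ accumulates on the whole space of $f$-invariant probabilities, i.e. $$\mathcal{M}_f(S^1)=\bigcap_{n\geq1}\overline{\{m_k:k\geq n\}},$$ the closure being in the weak* topology on Borel probabilities. *)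

theory Defs
  imports "HOL-Probability.Probability"
begin

section \<open>The circle\<close>

quotient_type circle = real / "\<lambda>x y :: real. x - y \<in> \<int>"
  morphisms rep_circle to_circle
proof (rule equivpI)
  show "reflp (\<lambda>x y :: real. x - y \<in> \<int>)"
    by (simp add: reflp_def)
  show "symp (\<lambda>x y :: real. x - y \<in> \<int>)"
  proof (rule sympI)
    fix x y :: real
    assume "x - y \<in> \<int>"
    then have "- (x - y) \<in> \<int>" by (rule Ints_minus)
    then show "y - x \<in> \<int>" by simp
  qed
  show "transp (\<lambda>x y :: real. x - y \<in> \<int>)"
  proof (rule transpI)
    fix x y z :: real
    assume "x - y \<in> \<int>" "y - z \<in> \<int>"
    then have "(x - y) + (y - z) \<in> \<int>" by (rule Ints_add)
    then show "x - z \<in> \<int>" by simp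
  qed
qed

lemma to_circle_eq_iff: "to_circle x = to_circle y \<longleftrightarrow> x - y \<in> \<int>"
  by (simp add: circle.abs_eq_iff)

lemma infdist_Ints_shift:
  fixes x y :: real
  assumes "x - y \<in> \<int>"
  shows "infdist x \<int> = infdist y \<int>"
proof -
  have le: "infdist u \<int> \<le> infdist v \<int>" if "u - v \<in> \<int>" for u v :: real
  proof -
    have "infdist u \<int> \<le> dist v a" if a: "a \<in> \<int>" for a
    proof -
      have "infdist u \<int> \<le> dist u (a + (u - v))"
        by (intro infdist_le Ints_add a \<open>u - v \<in> \<int>\<close>)
      also have "\<dots> = dist v a" by (simp add: dist_real_def)
      finally show ?thesis .
    qed
    moreover have "(\<int> :: real set) \<noteq> {}" using Ints_0 by blast
    ultimately show ?thesis
      by (simp add: infdist_notempty[of \<int> v] cINF_greatest)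
  qed
  have "y - x \<in> \<int>" using Ints_minus[OF assms] by simp
  then show ?thesis using le[of x y] le[of y x] assms by simp
qed

instantiation circle :: metric_space
begin

text \<open>The quotient distance: \<open>dist (to_circle x) (to_circle y)\<close> is the distance from
  \<open>x - y\<close> to the nearest integer.\<close>

lift_definition dist_circle :: "circle \<Rightarrow> circle \<Rightarrow> real" is "\<lambda>x y. infdist (x - y) \<int>"
proof -
  fix x x' y y' :: real
  assume "x - x' \<in> \<int>" "y - y' \<in> \<int>"
  then have "(x - x') - (y - y') \<in> \<int>" by (rule Ints_diff)
  then have "(x - y) - (x' - y') \<in> \<int>" by (simp add: algebra_simps)
  then show "infdist (x - y) \<int> = infdist (x' - y') \<int>" by (rule infdist_Ints_shift)
qed

definition uniformity_circle :: "(circle \<times> circle) filter" where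
  "uniformity_circle = (INF e\<in>{0<..}. principal {(x, y). dist x y < e})"

definition open_circle :: "circle set \<Rightarrow> bool" where
  "open_circle U \<longleftrightarrow> (\<forall>x\<in>U. \<forall>\<^sub>F (x', y) in uniformity. x' = x \<longrightarrow> y \<in> U)"

instance
proof
  fix x y z :: circle
  have ne: "(\<int> :: real set) \<noteq> {}" using Ints_0 by blast
  show "dist x y = 0 \<longleftrightarrow> x = y"
    by transfer (metis closed_Ints in_closed_iff_infdist_zero ne)
  show "dist x y \<le> dist x z + dist y z"
  proof transfer
    fix x y z :: real
    have neg: "infdist (- u) \<int> \<le> infdist u \<int>" for u :: real
    proof -
      have "infdist (- u) \<int> \<le> dist u a" if "a \<in> \<int>" for a
        using infdist_le[of "- a" \<int> "- u"] that by (simp add: dist_minus)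
      then show ?thesis by (simp add: infdist_notempty[of \<int> u] ne cINF_greatest)
    qed
    have add: "infdist (u + v) \<int> \<le> infdist u \<int> + infdist v \<int>" for u v :: real
    proof -
      have "infdist (u + v) \<int> - infdist u \<int> \<le> dist v b" if b: "b \<in> \<int>" for b
      proof -
        have "infdist (u + v) \<int> = infdist (u + v - b) \<int>"
          by (rule infdist_Ints_shift) (use b in simp)
        also have "\<dots> \<le> infdist u \<int> + dist (u + v - b) u" by (rule infdist_triangle)
        also have "dist (u + v - b) u = dist v b" by (simp add: dist_real_def)
        finally show ?thesis by simp
      qed
      then have "infdist (u + v) \<int> - infdist u \<int> \<le> infdist v \<int>"
        by (simp add: infdist_notempty[of \<int> v] ne cINF_greatest)
      then show ?thesis by simp
    qed
    show "infdist (x - y) \<int> \<le> infdist (x - z) \<int> + infdist (y - z) \<int>"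
      using add[of "x - z" "- (y - z)"] neg[of "y - z"] by simp
  qed
qed (simp_all only: uniformity_circle_def open_circle_def)

end

lemma dist_to_circle: "dist (to_circle x) (to_circle y) = infdist (x - y) \<int>"
  by transfer simp

lemma dist_to_circle_le: "dist (to_circle x) (to_circle y) \<le> dist x y"
  using infdist_le[of 0 \<int> "x - y"] by (simp add: dist_to_circle dist_real_def)

lemma continuous_to_circle: "continuous_on UNIV to_circle"
  unfolding continuous_on_iff using dist_to_circle_le le_less_trans by blast

lemma to_circle_measurable [measurable]: "to_circle \<in> borel_measurable borel"
  by (intro borel_measurable_continuous_onI continuous_to_circle)


section \<open>Expanding maps and their conjugates\<close>

lift_definition E_map :: "int \<Rightarrow> circle \<Rightarrow> circle" is "\<lambda>k x. of_int k * x"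
proof -
  fix k :: int and x y :: real
  assume "x - y \<in> \<int>"
  then have "of_int k * (x - y) \<in> \<int>" by (intro Ints_mult Ints_of_int)
  then show "of_int k * x - of_int k * y \<in> \<int>" by (simp add: right_diff_distrib)
qed

text \<open>A homeomorphism of the circle preserves orientation iff it has an increasing lift to the
  universal cover \<open>to_circle\<close>.\<close>

definition Homeo_plus :: "(circle \<Rightarrow> circle) set" where
  "Homeo_plus = {h. homeomorphic_map euclidean euclidean h \<and>
     (\<exists>H :: real \<Rightarrow> real. continuous_on UNIV H \<and> strict_mono H \<and>
        (\<forall>x. h (to_circle x) = to_circle (H x)))}"

text \<open>The type \<open>circle \<Rightarrow>\<^sub>C circle\<close> of bounded continuous maps, with its supremum
  distance, is the space of all continuous self-maps of the circle, which is bounded.\<close>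

definition CE_deg :: "int \<Rightarrow> (circle \<Rightarrow>\<^sub>C circle) set" where
  "CE_deg k = {f. \<exists>h\<in>Homeo_plus. apply_bcontfun f = h \<circ> E_map k \<circ> inv h}"

definition CE :: "(circle \<Rightarrow>\<^sub>C circle) set" where
  "CE = (\<Union>k\<in>{k. \<bar>k\<bar> \<ge> 2}. CE_deg k)"

lemma bcontfun_circle_iff: "(f :: circle \<Rightarrow> circle) \<in> bcontfun \<longleftrightarrow> continuous_on UNIV f"
proof -
  have "dist a b \<le> 1" for a b :: circle
  proof transfer
    fix a b :: real
    have "infdist (a - b) \<int> \<le> dist (a - b) (of_int \<lfloor>a - b\<rfloor>)" by (rule infdist_le) simp
    also have "\<dots> \<le> 1" unfolding dist_real_def by linarith
    finally show "infdist (a - b) \<int> \<le> 1" .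
  qed
  then have "bounded (range f)" unfolding bounded_def by blast
  then show ?thesis by (simp add: bcontfun_def)
qed

lemma continuous_E_map: "continuous_on UNIV (E_map k)"
proof -
  have "dist (E_map k x) (E_map k y) \<le> \<bar>of_int k\<bar> * dist x y" for x y
  proof transfer
    fix k :: int and x y :: real
    have ne: "(\<int> :: real set) \<noteq> {}" using Ints_0 by blast
    obtain n where n: "n \<in> \<int>" "infdist (x - y) \<int> = dist (x - y) n"
      using infdist_attains_inf[OF closed_Ints ne] by blast
    have "infdist (of_int k * x - of_int k * y) \<int> \<le> dist (of_int k * x - of_int k * y) (of_int k * n)"
      using n by (intro infdist_le) simp
    also have "\<dots> = \<bar>of_int k\<bar> * dist (x - y) n"
      by (simp add: dist_real_def flip: right_diff_distrib abs_mult)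
    finally show "infdist (of_int k * x - of_int k * y) \<int> \<le> \<bar>of_int k\<bar> * infdist (x - y) \<int>"
      using n by simp
  qed
  then show ?thesis
    by (intro lipschitz_on_continuous_on[of "\<bar>of_int k\<bar>"] lipschitz_onI) auto
qed

lemma CE_deg_eq:
  "CE_deg k = {Bcontfun (h \<circ> E_map k \<circ> inv h) |h. h \<in> Homeo_plus}"
proof -
  have *: "h \<circ> E_map k \<circ> inv h \<in> bcontfun" if "h \<in> Homeo_plus" for h
  proof -
    have hom: "homeomorphic_map euclidean euclidean h" using that by (simp add: Homeo_plus_def)
    then have bij: "bij h"
      using homeomorphic_imp_injective_map[OF hom] homeomorphic_imp_surjective_map[OF hom]
      by (simp add: bij_def)
    have ch: "continuous_on UNIV h"
      using homeomorphic_imp_continuous_map[OF hom] by simp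
    have "open_map euclidean euclidean h" using hom by (rule homeomorphic_imp_open_map)
    then have "open (inv h -` U)" if "open U" for U
      using that bij by (simp add: open_map_def bij_vimage_eq_inv_image bij_imp_bij_inv inv_inv_eq)
    then have ci: "continuous_on UNIV (inv h)"
      by (simp add: continuous_on_open_vimage)
    show ?thesis unfolding bcontfun_circle_iff
      by (intro continuous_on_compose ci continuous_on_subset[OF ch] continuous_on_subset[OF continuous_E_map]) auto
  qed
  then show ?thesis
    unfolding CE_deg_def by (auto simp: Bcontfun_inverse) (metis apply_bcontfun_inverse)
qed

definition residual_in :: "'a topology \<Rightarrow> 'a set \<Rightarrow> bool" where
  "residual_in X R \<longleftrightarrow> R \<subseteq> topspace X \<and>
     (\<exists>\<U>. countable \<U> \<and> (\<forall>U\<in>\<U>. openin X U \<and> X closure_of U = topspace X) \<and>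
          topspace X \<inter> \<Inter>\<U> \<subseteq> R)"


section \<open>Wicked maps\<close>

definition Lebesgue_circle :: "circle measure" where
  "Lebesgue_circle = distr (restrict_space lborel {0..<1}) borel to_circle"

lemma prob_space_Lebesgue_circle: "prob_space Lebesgue_circle"
  unfolding Lebesgue_circle_def
  by (intro prob_space.prob_space_distr prob_spaceI)
     (auto simp: space_restrict_space emeasure_restrict_space intro!: measurable_restrict_space1)

definition borel_probs :: "circle measure set" where
  "borel_probs = {\<mu>. prob_space \<mu> \<and> sets \<mu> = sets borel}"

text \<open>The coarsest topology making \<open>\<mu> \<mapsto> \<integral>\<phi> d\<mu>\<close> continuous for
  every continuous \<open>\<phi>\<close>.\<close>

definition weak_star :: "circle measure topology" where
  "weak_star = topology_generated_by
     {{\<mu> \<in> borel_probs. integral\<^sup>L \<mu> \<phi> \<in> U} |(\<phi> :: circle \<Rightarrow> real) U.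
        continuous_on UNIV \<phi> \<and> open U}"

lemma topspace_weak_star: "topspace weak_star = borel_probs"
proof -
  have "borel_probs \<in> {{\<mu> \<in> borel_probs. integral\<^sup>L \<mu> \<phi> \<in> U} |(\<phi> :: circle \<Rightarrow> real) U.
        continuous_on UNIV \<phi> \<and> open U}"
    by (rule CollectI, rule exI[of _ "\<lambda>_. 0"], rule exI[of _ UNIV]) simp
  then show ?thesis unfolding weak_star_def topology_generated_by_topspace by blast
qed

definition invariant_probs :: "(circle \<Rightarrow> circle) \<Rightarrow> circle measure set" where
  "invariant_probs f = {\<mu> \<in> borel_probs. distr \<mu> borel f = \<mu>}"

definition uniquely_ergodic :: "(circle \<Rightarrow> circle) \<Rightarrow> bool" where
  "uniquely_ergodic f \<longleftrightarrow> (\<exists>!\<mu>. \<mu> \<in> invariant_probs f)"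

definition avg_pushforward :: "(circle \<Rightarrow> circle) \<Rightarrow> nat \<Rightarrow> circle measure" where
  "avg_pushforward f n = measure_of UNIV (sets borel)
     (\<lambda>A. (\<Sum>k=1..n. emeasure (distr Lebesgue_circle borel (f ^^ k)) A) / of_nat n)"

text \<open>\<open>measure_of\<close> would silently return the zero measure if its argument were not
  countably additive.\<close>

lemma emeasure_avg_pushforward:
  assumes "A \<in> sets borel"
  shows "emeasure (avg_pushforward f n) A =
    (\<Sum>k=1..n. emeasure (distr Lebesgue_circle borel (f ^^ k)) A) / of_nat n"
proof -
  have "countably_additive (sets borel)
     (\<lambda>A. (\<Sum>k=1..n. emeasure (distr Lebesgue_circle borel (f ^^ k)) A) / of_nat n)"
  proof (rule countably_additiveI)
    fix A :: "nat \<Rightarrow> circle set"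
    assume A: "range A \<subseteq> sets borel" "disjoint_family A"
    have "(\<Sum>i. (\<Sum>k=1..n. emeasure (distr Lebesgue_circle borel (f ^^ k)) (A i)) / of_nat n) =
      (\<Sum>k=1..n. (\<Sum>i. emeasure (distr Lebesgue_circle borel (f ^^ k)) (A i))) / of_nat n"
      by (simp add: ennreal_suminf_divide suminf_sum)
    also have "\<dots> = (\<Sum>k=1..n. emeasure (distr Lebesgue_circle borel (f ^^ k)) (\<Union>i. A i)) / of_nat n"
      using A by (simp add: suminf_emeasure)
    finally show "(\<Sum>i. (\<Sum>k=1..n. emeasure (distr Lebesgue_circle borel (f ^^ k)) (A i)) / of_nat n) =
      (\<Sum>k=1..n. emeasure (distr Lebesgue_circle borel (f ^^ k)) (\<Union>i. A i)) / of_nat n" .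
  qed
  moreover have "sigma_algebra UNIV (sets (borel :: circle measure))"
    using sets.sigma_algebra_axioms[of "borel :: circle measure"] by simp
  ultimately show ?thesis
    unfolding avg_pushforward_def
    by (intro emeasure_measure_of_sigma) (auto simp: positive_def assms)
qed

definition wicked :: "(circle \<Rightarrow> circle) \<Rightarrow> bool" where
  "wicked f \<longleftrightarrow> \<not> uniquely_ergodic f \<and>
     invariant_probs f = (\<Inter>n\<in>{1..}. weak_star closure_of {avg_pushforward f k |k. k \<ge> n})"

end

theory Submission
  imports Defs
begin

text \<open>
  Fix finitely many test functions, a rational target vector and \<open>l\<close>, and let \<open>B\<close> be the open set of
  those \<open>f\<close> for which some \<open>m\<^sub>n\<close> with \<open>n \<ge> l\<close> has integrals close to the target. The union of
  \<open>B\<close> with the complement of its closure is open and dense, so generically \<open>f\<close> lies in \<open>B\<close>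
  as soon as it lies in the closure of \<open>B\<close>. It therefore suffices to show that every \<open>f\<close> lies in
  the closure of \<open>B\<close> when the target is close to the integrals against some \<open>f\<close>-invariant \<open>\<mu>\<close>.

  To this end cut the circle into short arcs. Expansion allows one to glue orbit segments, so
  every arc contains a point whose Birkhoff averages up to a common large time \<open>n\<close> are close to
  the integrals against \<open>\<mu>\<close>. A homeomorphism \<open>g\<close> which preserves the arcs approximately, and is hence
  close to the identity, can expand tiny neighbourhoods of these points to almost full measure.
  For the conjugate of \<open>f\<close> by \<open>g\<close>, the measure \<open>m\<^sub>n\<close> is then close to \<open>\<mu>\<close>.
\<close>

section \<open>The circle and its homeomorphisms\<close>

text \<open>The obstacle is that the perturbation must be C^0 small although \<open>n\<close> is
  large and common to all arcs. Conjugation resolves this: orbits of g f g^-1 are g-images of orbits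
  of f, hence as close to orbits of f as g is to the identity, at all times. So the number of arcs
  is fixed independently of \<open>n\<close>, then \<open>n\<close> is chosen, and only then the
  size of the tiny neighbourhoods, which depends on \<open>n\<close>. An invariant \<mu> may be
  non-ergodic, so a single orbit segment need not represent it; segments of several orbits are
  selected and glued. Expansion also lets any initial piece end exactly on a prescribed point, so
  every arc can be joined to the same long segment; this makes \<open>n\<close> common to all arcs.
  Countably many targets are enough because weak* closure is detected by bump functions from
  partitions of unity on the grids of mesh 1/N. Genericity serves only to put the invariant
  probabilities into the limit set; the converse inclusion is a telescoping argument for every
  continuous map, and unique ergodicity fails on all of \<open>CE\<close>.\<close>

lemma surj_to_circle: obtains x where "p = to_circle x"
  by (metis Quotient_circle Quotient_def)

lemma to_circle_add_int [simp]: "n \<in> \<int> \<Longrightarrow> to_circle (x + n) = to_circle x"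
  by (simp add: to_circle_eq_iff)

lemma lift_near:
  assumes "dist q (to_circle x) < e"
  obtains y where "q = to_circle y" "dist y x < e"
proof -
  obtain y where y: "q = to_circle y" by (rule surj_to_circle)
  have "infdist (y - x) \<int> < e" using assms y by (simp add: dist_to_circle)
  moreover have "(\<int> :: real set) \<noteq> {}" using Ints_0 by blast
  ultimately obtain n where n: "n \<in> \<int>" "dist (y - x) n < e"
    using infdist_attains_inf[OF closed_Ints] by metis
  show ?thesis
  proof
    show "q = to_circle (y + - n)" using n y by (metis Ints_minus to_circle_add_int)
    show "dist (y + - n) x < e" using n by (simp add: dist_real_def algebra_simps)
  qed
qed

text \<open>Nearby points of the circle have nearby lifts, so the metric topology is the quotient
  topology, and continuity of a circle map can be checked on a lift.\<close>

lemma open_circle_iff: "open V \<longleftrightarrow> open (to_circle -` V)"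
proof
  assume "open V"
  then show "open (to_circle -` V)"
    using continuous_to_circle by (simp add: open_vimage continuous_on_open_vimage)
next
  assume o: "open (to_circle -` V)"
  show "open V" unfolding open_dist
  proof
    fix p assume p: "p \<in> V"
    obtain x where x: "p = to_circle x" by (rule surj_to_circle)
    obtain e where e: "e > 0" "\<And>y. dist y x < e \<Longrightarrow> to_circle y \<in> V"
      using o p x unfolding open_dist by auto
    have "q \<in> V" if q: "dist q p < e" for q
    proof -
      obtain y where "q = to_circle y" "dist y x < e"
        using q unfolding x by (rule lift_near)
      then show ?thesis using e(2) by simp
    qed
    then show "\<exists>e>0. \<forall>y. dist y p < e \<longrightarrow> y \<in> V" using e(1) by blast
  qed
qed

lemma compact_circle: "compact (UNIV :: circle set)"
proof -
  have "UNIV \<subseteq> to_circle ` {0..1}"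
  proof
    fix p
    obtain x where x: "p = to_circle x" by (rule surj_to_circle)
    have "p = to_circle (frac x)" using x by (simp add: frac_def to_circle_eq_iff)
    then show "p \<in> to_circle ` {0..1}"
      using frac_ge_0[of x] frac_lt_1[of x] by (auto intro!: image_eqI[of _ _ "frac x"])
  qed
  then have "UNIV = to_circle ` {0..1}" by blast
  then show ?thesis
    using compact_continuous_image[OF continuous_on_subset[OF continuous_to_circle], of "{0..1}"] by simp
qed

lemma uniform_continuity_circle:
  fixes \<phi> :: "circle \<Rightarrow> 'b :: metric_space"
  assumes "continuous_on UNIV \<phi>" "e > 0"
  obtains d where "d > 0" "\<And>x y. dist x y < d \<Longrightarrow> dist (\<phi> x) (\<phi> y) < e"
  using compact_uniformly_continuous[OF assms(1) compact_circle] assms(2)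
  unfolding uniformly_continuous_on_def by (metis UNIV_I)

lemma uniform_continuity_circle_finite:
  fixes \<psi> :: "'i \<Rightarrow> circle \<Rightarrow> 'b :: metric_space"
  assumes "finite I" "\<And>i. i \<in> I \<Longrightarrow> continuous_on UNIV (\<psi> i)" "e > 0"
  obtains d where "d > 0" "\<And>i x y. i \<in> I \<Longrightarrow> dist x y < d \<Longrightarrow> dist (\<psi> i x) (\<psi> i y) < e"
proof -
  have "\<exists>d>0. \<forall>i\<in>I. \<forall>x y. dist x y < d \<longrightarrow> dist (\<psi> i x) (\<psi> i y) < e"
    using assms(1,2)
  proof (induction I)
    case empty then show ?case by (auto intro: exI[of _ 1])
  next
    case (insert j J)
    then obtain d1 where 1: "d1 > 0" "\<forall>i\<in>J. \<forall>x y. dist x y < d1 \<longrightarrow> dist (\<psi> i x) (\<psi> i y) < e" by auto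
    obtain d2 where 2: "d2 > 0" "\<And>x y. dist x y < d2 \<Longrightarrow> dist (\<psi> j x) (\<psi> j y) < e"
      using uniform_continuity_circle[of "\<psi> j"] insert.prems assms(3) by blast
    show ?case using 1 2 by (intro exI[of _ "min d1 d2"]) auto
  qed
  then show ?thesis using that by blast
qed

lemma bounded_continuous_circle:
  fixes \<phi> :: "circle \<Rightarrow> real"
  assumes "continuous_on UNIV \<phi>"
  obtains C where "C > 0" "\<And>x. \<bar>\<phi> x\<bar> \<le> C"
proof -
  have "bounded (range \<phi>)" by (intro compact_imp_bounded compact_continuous_image assms compact_circle)
  then show ?thesis using that unfolding bounded_pos by auto
qed

section \<open>Lifts of degree one and the circle homeomorphisms they induce\<close>

locale degree_one_lift =
  fixes K :: "real \<Rightarrow> real"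
  assumes cont: "continuous_on UNIV K" and mono: "strict_mono K"
    and shift1: "K (x + 1) = K x + 1"
begin

lemma shift_nat: "K (x + of_nat n) = K x + of_nat n"
proof (induction n)
  case (Suc n)
  have "K (x + of_nat (Suc n)) = K ((x + of_nat n) + 1)" by (simp add: algebra_simps)
  then show ?case using Suc by (simp add: shift1)
qed simp

lemma shift_int: "n \<in> \<int> \<Longrightarrow> K (x + n) = K x + n"
proof (erule Ints_cases)
  fix m :: int assume m: "n = of_int m"
  show ?thesis
  proof (cases "m \<ge> 0")
    case True then show ?thesis using shift_nat[of x "nat m"] m by simp
  next
    case False then show ?thesis using shift_nat[of "x + n" "nat (-m)"] m by simp
  qed
qed

lemma surj: "surj K"
proof -
  have "\<exists>x. K x = y" for y
  proof -
    define a where "a = y - K 0"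
    have "K (of_int \<lfloor>a\<rfloor>) \<le> y"
      using shift_int[of "of_int \<lfloor>a\<rfloor>" 0] by (simp add: a_def) linarith
    moreover have "y \<le> K (of_int \<lfloor>a\<rfloor> + 1)"
      using shift_int[of "of_int \<lfloor>a\<rfloor>" 0] by (simp add: a_def shift1) linarith
    ultimately show ?thesis
      using IVT'[of K "of_int \<lfloor>a\<rfloor>" y "of_int \<lfloor>a\<rfloor> + 1"] continuous_on_subset[OF cont] by auto
  qed
  then show ?thesis by (metis surjI)
qed

lemma inj: "inj K"
  using mono by (rule strict_mono_imp_inj_on)

text \<open>The inverse is increasing and its range is the whole line; a monotone function with open
  range has no jumps.\<close>

lemma degree_one_lift_inv: "degree_one_lift (inv K)"
proof
  have K_inv: "K (inv K y) = y" for y by (rule surj_f_inv_f[OF surj])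
  show sm: "strict_mono (inv K)"
    by (rule strict_monoI) (metis K_inv mono strict_mono_less)
  have "range (inv K) = UNIV" by (rule inj_imp_surj_inv[OF inj])
  then show "continuous_on UNIV (inv K)"
    by (intro continuous_onI_mono) (auto simp: strict_mono_leD[OF sm] open_UNIV)
  show "inv K (x + 1) = inv K x + 1" for x
    by (metis K_inv inv_f_f inj shift1)
qed

text \<open>The value is computed at the representative picked by \<open>rep_circle\<close>;
  \<open>shift_int\<close> makes that choice immaterial.\<close>

definition circle_map :: "circle \<Rightarrow> circle" where
  "circle_map p = to_circle (K (rep_circle p))"

lemma circle_map_to_circle: "circle_map (to_circle x) = to_circle (K x)"
proof -
  have "to_circle (rep_circle (to_circle x)) = to_circle x"
    by (metis Quotient_circle Quotient_def)
  then have i: "rep_circle (to_circle x) - x \<in> \<int>" by (simp add: to_circle_eq_iff)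
  have "K (x + (rep_circle (to_circle x) - x)) = K x + (rep_circle (to_circle x) - x)"
    by (rule shift_int[OF i])
  then show ?thesis using i by (simp add: circle_map_def to_circle_eq_iff)
qed

lemma continuous_circle_map: "continuous_on UNIV circle_map"
proof -
  have "open (circle_map -` V)" if "open V" for V
  proof -
    have "to_circle -` (circle_map -` V) = K -` (to_circle -` V)"
      by (auto simp: circle_map_to_circle)
    moreover have "open (K -` (to_circle -` V))"
      using that open_vimage[OF _ cont] by (simp add: open_circle_iff)
    ultimately show ?thesis by (simp add: open_circle_iff)
  qed
  then show ?thesis by (simp add: continuous_on_open_vimage)
qed

lemma dist_circle_map:
  assumes "\<And>x. \<bar>K x - x\<bar> \<le> d"
  shows "dist (circle_map p) p \<le> d"
proof -
  obtain x where x: "p = to_circle x" by (rule surj_to_circle)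
  show ?thesis using dist_to_circle_le[of "K x" x] assms[of x]
    by (simp add: x circle_map_to_circle dist_real_def)
qed

lemma
  shows circle_map_inv_circle_map: "degree_one_lift.circle_map (inv K) (circle_map p) = p"
    and circle_map_circle_map_inv: "circle_map (degree_one_lift.circle_map (inv K) p) = p"
proof -
  interpret i: degree_one_lift "inv K" by (rule degree_one_lift_inv)
  obtain x where x: "p = to_circle x" by (rule surj_to_circle)
  show "i.circle_map (circle_map p) = p" "circle_map (i.circle_map p) = p"
    by (simp_all add: x circle_map_to_circle i.circle_map_to_circle inj surj surj_f_inv_f)
qed

lemma circle_map_in_Homeo_plus: "circle_map \<in> Homeo_plus"
proof -
  interpret i: degree_one_lift "inv K" by (rule degree_one_lift_inv)
  have "homeomorphic_maps euclidean euclidean circle_map i.circle_map"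
    by (simp add: homeomorphic_maps_def continuous_circle_map i.continuous_circle_map
        circle_map_inv_circle_map circle_map_circle_map_inv)
  then show ?thesis
    unfolding Homeo_plus_def homeomorphic_map_maps using cont mono circle_map_to_circle by blast
qed

end

lemma Homeo_plus_compose:
  assumes "g \<in> Homeo_plus" "h \<in> Homeo_plus"
  shows "g \<circ> h \<in> Homeo_plus"
proof -
  obtain G H where G: "continuous_on UNIV G" "strict_mono G" "\<And>x. g (to_circle x) = to_circle (G x)"
    and H: "continuous_on UNIV H" "strict_mono H" "\<And>x. h (to_circle x) = to_circle (H x)"
    using assms unfolding Homeo_plus_def by blast
  have "continuous_on UNIV (G \<circ> H)"
    by (intro continuous_on_compose H continuous_on_subset[OF G(1)]) auto
  moreover have "strict_mono (G \<circ> H)" using G(2) H(2) by (auto simp: strict_mono_def)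
  moreover have "homeomorphic_map euclidean euclidean (g \<circ> h)"
    using assms by (auto simp: Homeo_plus_def intro: homeomorphic_map_compose)
  ultimately show ?thesis unfolding Homeo_plus_def using G(3) H(3)
    by (auto intro!: exI[of _ "G \<circ> H"])
qed

lemma Homeo_plusD:
  assumes "h \<in> Homeo_plus"
  shows "bij h" "continuous_on UNIV h" "continuous_on UNIV (inv h)"
proof -
  have hom: "homeomorphic_map euclidean euclidean h" using assms by (simp add: Homeo_plus_def)
  then show bij: "bij h"
    using homeomorphic_imp_injective_map[OF hom] homeomorphic_imp_surjective_map[OF hom]
    by (simp add: bij_def)
  show "continuous_on UNIV h" using homeomorphic_imp_continuous_map[OF hom] by simp
  obtain h' where h': "homeomorphic_maps euclidean euclidean h h'"
    using hom homeomorphic_map_maps by blast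
  then have "continuous_on UNIV h'" "\<And>x. h (h' x) = x" by (auto simp: homeomorphic_maps_def)
  moreover from this have "h' = inv h" using bij by (metis bij_inv_eq_iff ext)
  ultimately show "continuous_on UNIV (inv h)" by simp
qed

lemma continuous_on_funpow:
  fixes f :: "'a :: topological_space \<Rightarrow> 'a"
  assumes "continuous_on UNIV f"
  shows "continuous_on UNIV (f ^^ j)"
proof (induction j)
  case (Suc j)
  then show ?case
    using continuous_on_compose[OF Suc continuous_on_subset[OF assms]] by simp
qed (simp add: id_def)

section \<open>Orbits of the expanding maps\<close>

lemma E_map_to_circle: "E_map k (to_circle x) = to_circle (of_int k * x)"
  by (simp add: E_map.abs_eq)

lemma E_map_pow_to_circle: "(E_map k ^^ j) (to_circle x) = to_circle (of_int k ^ j * x)"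
  by (induction j) (simp_all add: E_map_to_circle mult.assoc)

text \<open>In the lift, moving the initial point by c / k^L moves its iterate at time L by c, and
  some c in [0, 1) reaches any point of the circle. At time j the displacement is c / k^(L - j), at
  most (1/2)^(L - j) since |k| is at least 2.\<close>

lemma orbit_correction:
  assumes k: "\<bar>k\<bar> \<ge> 2"
  obtains y where "(E_map k ^^ L) y = w"
    "\<And>j. j \<le> L \<Longrightarrow> dist ((E_map k ^^ j) y) ((E_map k ^^ j) x) \<le> (1/2) ^ (L - j)"
proof -
  obtain a where a: "x = to_circle a" by (rule surj_to_circle)
  obtain b where b: "w = to_circle b" by (rule surj_to_circle)
  define c where "c = frac (b - of_int k ^ L * a)"
  define y where "y = a + c / of_int k ^ L"
  have c: "0 \<le> c" "c < 1" by (simp_all add: c_def frac_lt_1)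
  have k0: "(of_int k :: real) \<noteq> 0" using k by auto
  have "of_int k ^ L * y - b = - of_int \<lfloor>b - of_int k ^ L * a\<rfloor>"
    using k0 by (simp add: y_def c_def frac_def field_simps)
  then have 1: "(E_map k ^^ L) (to_circle y) = w"
    by (simp add: E_map_pow_to_circle b to_circle_eq_iff)
  have 2: "dist ((E_map k ^^ j) (to_circle y)) ((E_map k ^^ j) x) \<le> (1/2) ^ (L - j)" if j: "j \<le> L" for j
  proof -
    have "(of_int k :: real) ^ L = of_int k ^ j * of_int k ^ (L - j)"
      using j by (simp flip: power_add)
    then have "of_int k ^ j * y - of_int k ^ j * a = c / of_int k ^ (L - j)"
      using k0 by (simp add: y_def field_simps)
    then have "dist ((E_map k ^^ j) (to_circle y)) ((E_map k ^^ j) x) \<le> \<bar>c / of_int k ^ (L - j)\<bar>"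
      using dist_to_circle_le[of "of_int k ^ j * y" "of_int k ^ j * a"]
      by (simp add: E_map_pow_to_circle a dist_real_def)
    also have "\<dots> = c / \<bar>of_int k\<bar> ^ (L - j)" using c by (simp add: power_abs)
    also have "\<dots> \<le> 1 / 2 ^ (L - j)"
    proof (rule frac_le)
      have "(2::real) \<le> \<bar>of_int k\<bar>" using k by linarith
      then show "2 ^ (L - j) \<le> \<bar>of_int k :: real\<bar> ^ (L - j)" by (rule power_mono) simp
    qed (use c in auto)
    finally show ?thesis by (simp add: power_one_over)
  qed
  show ?thesis using that 1 2 by blast
qed

text \<open>Blocks are attached from the last to the first: \<open>w\<close> follows the later
  blocks, and \<open>orbit_correction\<close> gives a point following \<open>x 0\<close> that lands
  exactly on \<open>w\<close> at time \<open>L\<close>. Exact landing keeps errors from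
  accumulating, so the bound is independent of \<open>Q\<close>.\<close>

lemma orbit_gluing:
  assumes k: "\<bar>k\<bar> \<ge> 2"
  shows "\<exists>z. \<forall>q<Q. \<forall>j<L. dist ((E_map k ^^ (q * L + j)) z) ((E_map k ^^ j) (x q)) \<le> (1/2) ^ (L - j)"
proof (induction Q arbitrary: x)
  case (Suc Q)
  obtain w where w: "\<And>q j. q < Q \<Longrightarrow> j < L \<Longrightarrow>
      dist ((E_map k ^^ (q * L + j)) w) ((E_map k ^^ j) (x (Suc q))) \<le> (1/2) ^ (L - j)"
    using Suc[of "\<lambda>q. x (Suc q)"] by blast
  obtain z where z: "(E_map k ^^ L) z = w"
    "\<And>j. j \<le> L \<Longrightarrow> dist ((E_map k ^^ j) z) ((E_map k ^^ j) (x 0)) \<le> (1/2) ^ (L - j)"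
    using orbit_correction[OF k] by metis
  have "dist ((E_map k ^^ (q * L + j)) z) ((E_map k ^^ j) (x q)) \<le> (1/2) ^ (L - j)"
    if "q < Suc Q" "j < L" for q j
  proof (cases q)
    case 0 then show ?thesis using z(2)[of j] that by simp
  next
    case (Suc r)
    have "(E_map k ^^ (q * L + j)) z = (E_map k ^^ ((r * L + j) + L)) z"
      by (simp add: Suc algebra_simps)
    also have "\<dots> = (E_map k ^^ (r * L + j)) w" by (simp only: funpow_add comp_apply z(1))
    finally show ?thesis using w[of r j] that Suc by simp
  qed
  then show ?case by blast
qed simp

text \<open>Each new point is chosen so that its deviation has nonpositive inner product with the accumulated
  deviation; hence the squared norm of the latter grows only linearly.\<close>

lemma (in prob_space) greedy_sampling:
  fixes F :: "'i \<Rightarrow> 'a \<Rightarrow> real"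
  assumes int: "\<And>i. i \<in> I \<Longrightarrow> integrable M (F i)"
    and bd: "\<And>i x. i \<in> I \<Longrightarrow> \<bar>F i x - expectation (F i)\<bar> \<le> c"
  obtains x where "\<And>Q. (\<Sum>i\<in>I. (\<Sum>q<Q. F i (x q) - expectation (F i))\<^sup>2) \<le> real Q * (real (card I) * c\<^sup>2)"
proof -
  define G where "G i y = F i y - expectation (F i)" for i y
  have Gint: "integrable M (G i)" "expectation (G i) = 0" if "i \<in> I" for i
    using int[OF that] by (simp_all add: G_def[abs_def] prob_space)
  \<comment> \<open>The combination has mean zero, so it cannot be positive everywhere.\<close>
  have "\<exists>y. (\<Sum>i\<in>I. e i * G i y) \<le> 0" for e :: "'i \<Rightarrow> real"
  proof (rule ccontr)
    assume "\<not> ?thesis"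
    then have pos: "(\<Sum>i\<in>I. e i * G i y) > 0" for y by (meson not_less)
    have i: "integrable M (\<lambda>y. \<Sum>i\<in>I. e i * G i y)" using Gint by auto
    have "expectation (\<lambda>y. \<Sum>i\<in>I. e i * G i y) = 0" using Gint by (simp add: Bochner_Integration.integral_sum)
    then have "AE y in M. (\<Sum>i\<in>I. e i * G i y) = 0"
      using integral_nonneg_eq_0_iff_AE[OF i] pos by (simp add: less_imp_le)
    then have "AE y in M. False" by eventually_elim (use pos in \<open>simp add: less_le\<close>)
    then show False by simp
  qed
  then obtain pick where pick: "\<And>e :: 'i \<Rightarrow> real. (\<Sum>i\<in>I. e i * G i (pick e)) \<le> 0" by metis
  define e where "e = rec_nat (\<lambda>_. 0) (\<lambda>_ e i. e i + G i (pick e))"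
  have e0: "e 0 = (\<lambda>_. 0)" and eS: "e (Suc Q) = (\<lambda>i. e Q i + G i (pick (e Q)))" for Q
    by (simp_all add: e_def)
  have e_sum: "e Q i = (\<Sum>q<Q. G i (pick (e q)))" for Q i
    by (induction Q) (simp_all add: e0 eS)
  have "(\<Sum>i\<in>I. (e Q i)\<^sup>2) \<le> real Q * (real (card I) * c\<^sup>2)" for Q
  proof (induction Q)
    case (Suc Q)
    have "(\<Sum>i\<in>I. (e (Suc Q) i)\<^sup>2) =
      (\<Sum>i\<in>I. (e Q i)\<^sup>2) + 2 * (\<Sum>i\<in>I. e Q i * G i (pick (e Q))) + (\<Sum>i\<in>I. (G i (pick (e Q)))\<^sup>2)"
      by (simp add: eS power2_sum sum.distrib sum_distrib_left algebra_simps)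
    moreover have "(\<Sum>i\<in>I. (G i (pick (e Q)))\<^sup>2) \<le> real (card I) * c\<^sup>2"
    proof (rule sum_bounded_above)
      fix i assume "i \<in> I"
      then have "\<bar>G i (pick (e Q))\<bar> \<le> c" using bd by (simp add: G_def)
      then show "(G i (pick (e Q)))\<^sup>2 \<le> c\<^sup>2" by (metis abs_ge_zero power2_abs power_mono)
    qed
    ultimately show ?case using Suc pick[of "e Q"] by (simp add: algebra_simps)
  qed (simp add: e0)
  then show ?thesis using that[of "\<lambda>q. pick (e q)"] by (simp add: e_sum G_def)
qed

lemma integral_invariant_funpow:
  fixes f :: "'a :: topological_space \<Rightarrow> 'a" and \<psi> :: "'a \<Rightarrow> real"
  assumes inv: "distr M borel f = M" and f: "continuous_on UNIV f"
    and \<psi>: "\<psi> \<in> borel_measurable borel"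
  shows "(\<integral>x. \<psi> ((f ^^ j) x) \<partial>M) = (\<integral>x. \<psi> x \<partial>M)"
proof (induction j)
  case (Suc j)
  have sets: "sets M = sets borel" using inv by (metis sets_distr)
  have "f \<in> borel_measurable borel" "f ^^ j \<in> borel_measurable borel"
    using f continuous_on_funpow[OF f] by (auto intro: borel_measurable_continuous_onI)
  then have "(\<integral>x. \<psi> ((f ^^ j) x) \<partial>(distr M borel f)) = (\<integral>x. \<psi> ((f ^^ j) (f x)) \<partial>M)"
    using \<psi> by (intro integral_distr) (auto simp: measurable_cong_sets[OF sets refl] intro: measurable_compose)
  then show ?case using Suc by (simp add: inv funpow_swap1)
qed simp

lemma sum_lessThan_add:
  fixes f :: "nat \<Rightarrow> 'a :: comm_monoid_add"
  shows "(\<Sum>m<T+N. f m) = (\<Sum>m<T. f m) + (\<Sum>m<N. f (T + m))"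
  by (induction N) (simp_all add: add.assoc)

lemma sum_lessThan_mult:
  fixes f :: "nat \<Rightarrow> 'a :: comm_monoid_add"
  shows "(\<Sum>m<Q*L. f m) = (\<Sum>q<Q. \<Sum>j<L. f (q * L + j))"
proof (induction Q)
  case (Suc Q)
  have "(\<Sum>m<Suc Q * L. f m) = (\<Sum>m<Q * L + L. f m)" by (simp add: add.commute)
  then show ?case using Suc by (simp only: sum_lessThan_add sum.lessThan_Suc)
qed simp

text \<open>A point \<open>z\<close> glued from \<open>Q\<close> sampled blocks has averages close
  to the integrals against \<open>\<mu>\<close>. For each \<open>U\<close> some point of
  \<open>U\<close> is made to land on \<open>z\<close> at a fixed time, so one \<open>n\<close>
  serves all of \<open>\<O>\<close>. Four errors are kept to a share \<open>\<epsilon> / 4\<close>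
  each: shadowing inside the blocks, the coarse ends of the blocks, the sampling deviation and the
  initial steps before \<open>z\<close>.\<close>

lemma expanding_orbit_averages:
  fixes \<psi> :: "'i \<Rightarrow> circle \<Rightarrow> real"
  assumes k: "\<bar>k\<bar> \<ge> 2" and \<mu>: "prob_space \<mu>" and inv: "distr \<mu> borel (E_map k) = \<mu>"
    and I: "finite I" "\<And>i. i \<in> I \<Longrightarrow> continuous_on UNIV (\<psi> i)"
    and bd: "\<And>i x. i \<in> I \<Longrightarrow> \<psi> i x \<in> {0..1}" and \<epsilon>: "\<epsilon> > 0"
    and \<O>: "finite \<O>" "\<And>U. U \<in> \<O> \<Longrightarrow> open U \<and> U \<noteq> {}"
  obtains n where "n \<ge> l" "n > 0"
    "\<forall>U\<in>\<O>. \<exists>p\<in>U. \<forall>i\<in>I. \<bar>(\<Sum>j=1..n. \<psi> i ((E_map k ^^ j) p)) / n - (\<integral>x. \<psi> i x \<partial>\<mu>)\<bar> \<le> \<epsilon>"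
proof -
  interpret prob_space \<mu> by (rule \<mu>)
  define E where "E = E_map k"
  define a where "a i = expectation (\<psi> i)" for i
  have sets: "sets \<mu> = sets borel" using inv by (metis sets_distr)
  have contE: "continuous_on UNIV (E ^^ j)" for j
    unfolding E_def by (intro continuous_on_funpow continuous_E_map)
  have meas: "(\<lambda>x. \<psi> i ((E ^^ j) x)) \<in> borel_measurable \<mu>" if "i \<in> I" for i j
    unfolding measurable_cong_sets[OF sets refl]
    by (intro borel_measurable_continuous_onI continuous_on_compose2[OF I(2)[OF that] contE]) auto
  have int: "integrable \<mu> (\<lambda>x. \<psi> i ((E ^^ j) x))" if "i \<in> I" for i j
    using bd[OF that] by (intro integrable_const_bound[where B=1] meas that) auto
  have a: "0 \<le> a i" "a i \<le> 1" if "i \<in> I" for i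
    using Bochner_Integration.integral_nonneg[of \<mu> "\<psi> i"] integral_le_const[OF int[of i 0], of 1] bd that
    unfolding a_def by auto

  obtain d where d: "d > 0" "\<And>i x y. i \<in> I \<Longrightarrow> dist x y < d \<Longrightarrow> dist (\<psi> i x) (\<psi> i y) < \<epsilon>/4"
    using uniform_continuity_circle_finite[of I \<psi> "\<epsilon>/4"] I \<epsilon> by auto
  \<comment> \<open>\<open>c\<close> counts the final times of a block at which shadowing may be
    coarser than \<open>d\<close>; \<open>L\<close> is then taken so long that these times cost at
    most \<open>L * \<epsilon> / 4\<close>.\<close>
  obtain c :: nat where c: "(1/2) ^ c < d" using real_arch_pow_inv[OF d(1), of "1/2"] by auto
  obtain L0 :: nat where L0: "real L0 \<ge> 4 * c / \<epsilon>" using real_arch_simple by blast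
  define L where "L = c + L0 + 1"
  have L: "L > 0" "c \<le> L" by (simp_all add: L_def)
  have "4 * c \<le> L0 * \<epsilon>" using L0 \<epsilon> by (simp add: pos_divide_le_eq)
  also have "\<dots> \<le> L * \<epsilon>" using \<epsilon> by (intro mult_right_mono) (simp_all add: L_def)
  finally have Lc: "real c \<le> L * \<epsilon> / 4" by simp
  define F where "F i x = (\<Sum>j<L. \<psi> i ((E ^^ j) x))" for i x
  have F: "integrable \<mu> (F i)" "expectation (F i) = L * a i" "0 \<le> F i x" "F i x \<le> L" if "i \<in> I" for i x
  proof -
    show "integrable \<mu> (F i)" unfolding F_def[abs_def] using int that by auto
    have "expectation (\<lambda>x. \<psi> i ((E ^^ j) x)) = a i" for j
      unfolding a_def E_def
      by (intro integral_invariant_funpow[OF inv] continuous_E_map borel_measurable_continuous_onI I that)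
    then show "expectation (F i) = L * a i"
      unfolding F_def[abs_def] using int that by (simp add: Bochner_Integration.integral_sum)
    show "0 \<le> F i x" unfolding F_def using bd that by (intro sum_nonneg) auto
    show "F i x \<le> L" unfolding F_def using sum_bounded_above[of "{..<L}" "\<lambda>j. \<psi> i ((E ^^ j) x)" 1] bd that by auto
  qed
  have Fbd: "\<bar>F i x - expectation (F i)\<bar> \<le> real L" if "i \<in> I" for i x
    using F(3,4)[OF that, of x] a[OF that] mult_left_mono[of "a i" 1 "real L"] mult_nonneg_nonneg[of "real L" "a i"]
    unfolding F(2)[OF that] abs_le_iff by linarith
  obtain x where x: "\<And>Q. (\<Sum>i\<in>I. (\<Sum>q<Q. F i (x q) - expectation (F i))\<^sup>2) \<le> real Q * (real (card I) * (real L)\<^sup>2)"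
    using greedy_sampling[of I F "real L", OF F(1) Fbd] by blast

  have "\<exists>p t. ball p ((1/2) ^ t) \<subseteq> U" if U: "U \<in> \<O>" for U
  proof -
    obtain p where "p \<in> U" using \<O>(2)[OF U] by blast
    then obtain e where e: "e > 0" "ball p e \<subseteq> U" using \<O>(2)[OF U] open_contains_ball by blast
    obtain t :: nat where "(1/2) ^ t < e" using real_arch_pow_inv[OF e(1), of "1/2"] by auto
    then have "ball p ((1/2) ^ t) \<subseteq> ball p e" by (intro subset_ball) simp
    then show ?thesis using e by blast
  qed
  then obtain p t where pt: "\<And>U. U \<in> \<O> \<Longrightarrow> ball (p U) ((1/2) ^ t U) \<subseteq> U" by metis
  \<comment> \<open>The sum is merely a common upper bound for all the \<open>t U\<close>.\<close>
  define T where "T = (\<Sum>U\<in>\<O>. t U)"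
  have T: "t U \<le> T" if "U \<in> \<O>" for U unfolding T_def using that \<O>(1) by (intro member_le_sum) auto

  \<comment> \<open>The bound by \<open>l\<close> gives \<open>n \<ge> l\<close>. Since the sampling
    deviation grows only like the square root of \<open>Q\<close>, the bound
    \<open>16 * card I / \<epsilon>\<^sup>2\<close> brings it down to
    \<open>Q * L * \<epsilon> / 4\<close>. The bound \<open>4 * T / \<epsilon>\<close> absorbs the
    initial steps.\<close>
  obtain Q :: nat where "real Q \<ge> max (max l 1) (max (16 * card I / \<epsilon>\<^sup>2) (4 * T / \<epsilon>))"
    using real_arch_simple by blast
  then have Q: "Q \<ge> l" "Q \<ge> 1" "16 * card I \<le> Q * \<epsilon>\<^sup>2" "4 * T \<le> Q * \<epsilon>"
    using \<epsilon> by (auto simp: field_simps)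
  have S: "\<bar>\<Sum>q<Q. F i (x q) - expectation (F i)\<bar> \<le> Q * L * \<epsilon> / 4" if "i \<in> I" for i
  proof -
    have "(\<Sum>q<Q. F i (x q) - expectation (F i))\<^sup>2 \<le> (\<Sum>i\<in>I. (\<Sum>q<Q. F i (x q) - expectation (F i))\<^sup>2)"
      using that I(1) by (intro member_le_sum) auto
    also have "\<dots> \<le> real Q * (real L)\<^sup>2 * card I" using x[of Q] by (simp add: mult_ac)
    also have "\<dots> \<le> real Q * (real L)\<^sup>2 * (Q * \<epsilon>\<^sup>2 / 16)" using Q(3) by (intro mult_left_mono) auto
    also have "\<dots> = (Q * L * \<epsilon> / 4)\<^sup>2" by (simp add: power2_eq_square)
    finally show ?thesis using abs_le_square_iff[of "\<Sum>q<Q. F i (x q) - expectation (F i)" "Q * L * \<epsilon> / 4"] \<epsilon> by simp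
  qed
  obtain z where z: "\<And>q j. q < Q \<Longrightarrow> j < L \<Longrightarrow> dist ((E ^^ (q * L + j)) z) ((E ^^ j) (x q)) \<le> (1/2) ^ (L - j)"
    using orbit_gluing[OF k, of Q L x] unfolding E_def by blast
  define n where "n = T + Q * L"
  have block: "\<bar>(\<Sum>j<L. \<psi> i ((E ^^ (q * L + j)) z)) - F i (x q)\<bar> \<le> L * \<epsilon> / 4 + c" if q: "q < Q" and i: "i \<in> I" for q i
  proof -
    \<comment> \<open>The last \<open>c\<close> times only get the trivial bound 1 for values in
      [0, 1], counted by \<open>of_bool\<close>.\<close>
    have "\<bar>\<psi> i ((E ^^ (q * L + j)) z) - \<psi> i ((E ^^ j) (x q))\<bar> \<le> \<epsilon>/4 + of_bool (L - c \<le> j)" if j: "j < L" for j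
    proof (cases "L - c \<le> j")
      case True
      then show ?thesis using bd[OF i, of "(E ^^ (q * L + j)) z"] bd[OF i, of "(E ^^ j) (x q)"] \<epsilon> by (simp add: abs_le_iff)
    next
      case False
      then have "(1/2) ^ (L - j) \<le> ((1/2) ^ c :: real)" by (intro power_decreasing) auto
      then have "dist (\<psi> i ((E ^^ (q * L + j)) z)) (\<psi> i ((E ^^ j) (x q))) < \<epsilon>/4"
        using z[OF q j] c by (intro d i) linarith
      then show ?thesis by (simp add: dist_real_def)
    qed
    then have "(\<Sum>j<L. \<bar>\<psi> i ((E ^^ (q * L + j)) z) - \<psi> i ((E ^^ j) (x q))\<bar>)
        \<le> (\<Sum>j<L. \<epsilon>/4 + of_bool (L - c \<le> j))" by (intro sum_mono) auto
    also have "\<dots> = L * \<epsilon> / 4 + card ({..<L} \<inter> {j. L - c \<le> j})" by (simp add: sum.distrib)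
    also have "{..<L} \<inter> {j. L - c \<le> j} = {L - c..<L}" by auto
    also have "card {L - c..<L} = c" using L(2) by simp
    finally show ?thesis
      unfolding F_def by (simp add: sum_subtractf[symmetric] order_trans[OF sum_abs])
  qed
  have "\<exists>y\<in>U. \<forall>i\<in>I. \<bar>(\<Sum>j=1..n. \<psi> i ((E ^^ j) y)) / n - a i\<bar> \<le> \<epsilon>" if U: "U \<in> \<O>" for U
  proof -
    \<comment> \<open>The landing time is \<open>T + 1\<close> because averages start at time 1:
      exactly the times 1 to \<open>T\<close> precede the orbit of \<open>z\<close>. The extra step
      also makes the distance to \<open>p U\<close> strictly smaller than the radius of the
      ball.\<close>
    obtain y where y: "(E ^^ (T + 1)) y = z" "\<And>j. j \<le> T + 1 \<Longrightarrow> dist ((E ^^ j) y) ((E ^^ j) (p U)) \<le> (1/2) ^ (T + 1 - j)"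
      using orbit_correction[OF k, of "T + 1" z "p U"] unfolding E_def by blast
    have "dist y (p U) \<le> (1/2) ^ (T + 1)" using y(2)[of 0] by simp
    also have "\<dots> < (1/2) ^ t U" using T[OF U] by (intro power_strict_decreasing) auto
    finally have "y \<in> U" using pt[OF U] by (auto simp: dist_commute)
    moreover have "\<bar>(\<Sum>j=1..n. \<psi> i ((E ^^ j) y)) / n - a i\<bar> \<le> \<epsilon>" if i: "i \<in> I" for i
    proof -
      have orb: "(E ^^ Suc (T + m)) y = (E ^^ m) z" for m
      proof -
        have "Suc (T + m) = m + (T + 1)" by simp
        then show ?thesis by (simp only: funpow_add[of m "T + 1"] comp_apply y(1))
      qed
      define A where "A = (\<Sum>m<T. \<psi> i ((E ^^ Suc m) y))"
      have A: "0 \<le> A" "A \<le> T"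
        using bd[OF i] sum_bounded_above[of "{..<T}" "\<lambda>m. \<psi> i ((E ^^ Suc m) y)" 1]
        by (auto simp: A_def intro!: sum_nonneg)
      have "(\<Sum>j=1..n. \<psi> i ((E ^^ j) y)) = (\<Sum>m<T + Q * L. \<psi> i ((E ^^ Suc m) y))"
        by (simp only: n_def One_nat_def sum.atLeast_Suc_atMost_Suc_shift sum.atLeast1_atMost_eq)
      also have "\<dots> = A + (\<Sum>q<Q. \<Sum>j<L. \<psi> i ((E ^^ (q * L + j)) z))"
        by (simp only: sum_lessThan_add sum_lessThan_mult orb A_def)
      finally have 1: "(\<Sum>j=1..n. \<psi> i ((E ^^ j) y)) = \<dots>" .
      have "\<bar>\<Sum>q<Q. (\<Sum>j<L. \<psi> i ((E ^^ (q * L + j)) z)) - F i (x q)\<bar> \<le> (\<Sum>q<Q. L * \<epsilon> / 4 + c)"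
        using block i by (intro order_trans[OF sum_abs] sum_mono) auto
      also have "\<dots> \<le> Q * (L * \<epsilon> / 4 + L * \<epsilon> / 4)" unfolding sum_constant card_lessThan by (intro mult_left_mono add_left_mono Lc) auto
      finally have 2: "\<bar>(\<Sum>q<Q. \<Sum>j<L. \<psi> i ((E ^^ (q * L + j)) z)) - (\<Sum>q<Q. F i (x q))\<bar> \<le> Q * L * \<epsilon> / 2"
        by (simp add: sum_subtractf algebra_simps)
      have 3: "\<bar>(\<Sum>q<Q. F i (x q)) - Q * L * a i\<bar> \<le> Q * L * \<epsilon> / 4"
        using S[OF i] F(2)[OF i] by (simp add: sum_subtractf mult.assoc)
      have 4: "0 \<le> T * a i" "T * a i \<le> T" using a[OF i] by (auto simp: mult_left_le)
      have "Q * \<epsilon> \<le> Q * \<epsilon> * L" using L(1) \<epsilon> mult_left_mono[of 1 "real L" "Q * \<epsilon>"] by simp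
      then have 5: "T \<le> Q * L * \<epsilon> / 4" using Q(4) by (simp add: mult_ac)
      have "\<bar>(\<Sum>j=1..n. \<psi> i ((E ^^ j) y)) - n * a i\<bar> \<le> Q * L * \<epsilon>"
      proof -
        have "(\<Sum>j=1..n. \<psi> i ((E ^^ j) y)) - n * a i = (A - T * a i) +
          ((\<Sum>q<Q. \<Sum>j<L. \<psi> i ((E ^^ (q * L + j)) z)) - (\<Sum>q<Q. F i (x q))) +
          ((\<Sum>q<Q. F i (x q)) - Q * L * a i)"
          unfolding 1 by (simp add: n_def algebra_simps)
        then show ?thesis using A 2 3 4 5 by linarith
      qed
      also have "\<dots> \<le> n * \<epsilon>" using \<epsilon> by (simp add: n_def algebra_simps)
      finally have "\<bar>(\<Sum>j=1..n. \<psi> i ((E ^^ j) y)) - n * a i\<bar> \<le> n * \<epsilon>" .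
      moreover have n0: "n > 0" using Q(2) L(1) by (simp add: n_def)
      ultimately have "\<bar>((\<Sum>j=1..n. \<psi> i ((E ^^ j) y)) - n * a i) / n\<bar> \<le> \<epsilon>"
        by (simp add: pos_divide_le_eq mult.commute)
      then show ?thesis using n0 by (simp add: diff_divide_distrib)
    qed
    ultimately show ?thesis by blast
  qed
  moreover have "n > 0" using Q(2) L(1) by (simp add: n_def)
  moreover have "n \<ge> l" using Q(1) L(1) mult_le_mono[of l Q 1 L] by (simp add: n_def)
  ultimately show ?thesis using that unfolding E_def a_def by blast
qed

section \<open>Weak* topology on the circle\<close>

lemma integrable_continuous_circle:
  fixes \<phi> :: "circle \<Rightarrow> real"
  assumes "\<mu> \<in> borel_probs" "continuous_on UNIV \<phi>"
  shows "integrable \<mu> \<phi>"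
proof -
  interpret prob_space \<mu> using assms(1) by (simp add: borel_probs_def)
  obtain C where C: "\<And>x. \<bar>\<phi> x\<bar> \<le> C" using bounded_continuous_circle[OF assms(2)] by blast
  have "\<phi> \<in> borel_measurable \<mu>"
    using assms by (auto simp: borel_probs_def cong: measurable_cong_sets intro: borel_measurable_continuous_onI)
  then show ?thesis using C by (intro integrable_const_bound[of _ C]) auto
qed

section \<open>Measures tested by continuous functions, and limits of the averages\<close>

lemma prob_measure_eqI_continuous:
  fixes M N :: "'a :: metric_space measure"
  assumes "prob_space M" "prob_space N" and sets: "sets M = sets borel" "sets N = sets borel"
    and eq: "\<And>\<phi> :: 'a \<Rightarrow> real. continuous_on UNIV \<phi> \<Longrightarrow> (\<And>x. \<phi> x \<in> {0..1}) \<Longrightarrow>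
      (\<integral>x. \<phi> x \<partial>M) = (\<integral>x. \<phi> x \<partial>N)"
  shows "M = N"
proof -
  interpret M: prob_space M by fact
  interpret N: prob_space N by fact
  have lim: "(\<lambda>n. \<integral>x. max 0 (1 - real n * infdist x A) \<partial>P) \<longlonglongrightarrow> measure P A"
    if A: "closed A" "A \<noteq> {}" and P: "prob_space P" "sets P = sets borel" for A :: "'a set" and P
  proof -
    interpret P: prob_space P by fact
    have "(\<lambda>n. \<integral>x. max 0 (1 - real n * infdist x A) \<partial>P) \<longlonglongrightarrow> (\<integral>x. indicator A x \<partial>P)"
    proof (rule integral_dominated_convergence[where w="\<lambda>_. 1"])
      show "AE x in P. (\<lambda>n. max 0 (1 - real n * infdist x A)) \<longlonglongrightarrow> indicator A x"
      proof (rule AE_I2)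
        fix x
        show "(\<lambda>n. max 0 (1 - real n * infdist x A)) \<longlonglongrightarrow> indicator A x"
        proof (cases "x \<in> A")
          case True then show ?thesis by simp
        next
          case False
          then have pos: "infdist x A > 0" using A in_closed_iff_infdist_zero[of A x] infdist_nonneg[of x A] by force
          obtain n0 :: nat where n0: "1 / infdist x A \<le> real n0" using real_arch_simple by blast
          have "\<forall>\<^sub>F n in sequentially. max 0 (1 - real n * infdist x A) = 0"
          proof (rule eventually_sequentiallyI[of n0])
            fix n assume "n0 \<le> n"
            then have "1 / infdist x A \<le> real n" using n0 by linarith
            then show "max 0 (1 - real n * infdist x A) = 0" using pos by (simp add: field_simps)
          qed
          then show ?thesis using False by (simp add: tendsto_eventually)
        qed
      qed
      show "(\<lambda>x. max 0 (1 - real n * infdist x A)) \<in> borel_measurable P" for n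
        unfolding measurable_cong_sets[OF P(2) refl]
        by (intro borel_measurable_continuous_onI continuous_intros)
      show "(\<lambda>x. indicator A x :: real) \<in> borel_measurable P"
        using A by (intro borel_measurable_indicator) (simp add: P(2))
      show "AE x in P. norm (max 0 (1 - real n * infdist x A)) \<le> 1" for n
        by (auto simp: infdist_nonneg)
    qed simp
    then show ?thesis using A by (simp add: P(2))
  qed
  have "emeasure M A = emeasure N A" if A: "closed A" for A
  \<comment> \<open>The empty set is separate: by convention \<open>infdist x {}\<close> is 0, so
    the approximating functions would be constantly 1 instead of tending to the indicator.\<close>
  proof (cases "A = {}")
    case False
    have "(\<integral>x. max 0 (1 - real n * infdist x A) \<partial>M) = (\<integral>x. max 0 (1 - real n * infdist x A) \<partial>N)" for n
      by (intro eq continuous_intros) (auto simp: infdist_nonneg)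
    then have "measure M A = measure N A"
      using lim[OF A False \<open>prob_space M\<close> sets(1)] lim[OF A False \<open>prob_space N\<close> sets(2)]
      by (simp add: LIMSEQ_unique)
    then show ?thesis by (simp add: M.emeasure_eq_measure N.emeasure_eq_measure)
  qed simp
  then show ?thesis
    using sets by (intro measure_eqI_generator_eq[where E="Collect closed" and \<Omega>=UNIV and A="\<lambda>_. UNIV"])
      (auto simp: Int_stable_def borel_eq_closed)
qed

lemma measurable_funpow_borel:
  fixes f :: "'a :: topological_space \<Rightarrow> 'a"
  assumes "continuous_on UNIV f"
  shows "f ^^ j \<in> borel_measurable borel"
  by (intro borel_measurable_continuous_onI continuous_on_funpow assms)

lemma sets_avg_pushforward [simp]: "sets (avg_pushforward f n) = sets borel"
  using sets.sigma_sets_eq[of "borel :: circle measure"] by (simp add: avg_pushforward_def)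

text \<open>Both claims come from exact formulas: the total mass is an average of ones, and the
  measure is the \<open>bind\<close> of the uniform distribution on {1..n} with the kernel of
  push-forwards, so that \<open>integral_bind\<close> yields the average of integrals.\<close>

lemma
  fixes f :: "circle \<Rightarrow> circle"
  assumes f: "continuous_on UNIV f" and n: "n > 0"
  shows avg_pushforward_in_borel_probs: "avg_pushforward f n \<in> borel_probs"
    and integral_avg_pushforward: "continuous_on UNIV (\<phi> :: circle \<Rightarrow> real) \<Longrightarrow>
      (\<integral>x. \<phi> x \<partial>avg_pushforward f n) = (\<Sum>j=1..n. \<integral>x. \<phi> ((f ^^ j) x) \<partial>Lebesgue_circle) / n"
proof -
  interpret L: prob_space Lebesgue_circle by (rule prob_space_Lebesgue_circle)
  define N where "N j = distr Lebesgue_circle borel (f ^^ j)" for j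
  define p where "p = pmf_of_set {1..n}"
  have setsL: "sets Lebesgue_circle = sets borel" by (simp add: Lebesgue_circle_def)
  have fm: "f ^^ j \<in> Lebesgue_circle \<rightarrow>\<^sub>M borel" for j
    unfolding measurable_cong_sets[OF setsL refl] by (rule measurable_funpow_borel[OF f])
  have Np: "prob_space (N j)" for j unfolding N_def by (rule L.prob_space_distr[OF fm])
  have "N j \<in> space (subprob_algebra borel)" for j
    using prob_space_imp_subprob_space[OF Np] by (auto simp: space_subprob_algebra N_def)
  then have Nk: "N \<in> measure_pmf p \<rightarrow>\<^sub>M subprob_algebra borel" by simp
  have fin: "{1..n} \<noteq> {}" "finite {1..n}" using n by auto
  have "avg_pushforward f n = measure_pmf p \<bind> N"
  proof (rule measure_eqI)
    show "sets (avg_pushforward f n) = sets (measure_pmf p \<bind> N)"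
      using sets_bind[OF sets_kernel[OF Nk], of "measure_pmf p"]
      by simp
    fix A assume "A \<in> sets (avg_pushforward f n)"
    then have A: "A \<in> sets borel" by simp
    have "emeasure (measure_pmf p \<bind> N) A = (\<integral>\<^sup>+j. emeasure (N j) A \<partial>measure_pmf p)"
      by (rule emeasure_bind[OF _ Nk A]) simp
    also have "\<dots> = (\<Sum>j=1..n. emeasure (N j) A) / n"
      unfolding p_def by (subst nn_integral_pmf_of_set[OF fin]) simp
    finally show "emeasure (avg_pushforward f n) A = emeasure (measure_pmf p \<bind> N) A"
      by (simp add: emeasure_avg_pushforward[OF A] N_def)
  qed
  note bind = this
  have "emeasure (avg_pushforward f n) UNIV = 1"
    using n prob_space.emeasure_space_1[OF Np]
    by (simp add: emeasure_avg_pushforward N_def ennreal_divide_self of_nat_less_top)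
  then have "prob_space (avg_pushforward f n)"
    using sets_eq_imp_space_eq[OF sets_avg_pushforward[of f n]] by (intro prob_spaceI) simp
  then show "avg_pushforward f n \<in> borel_probs"
    by (simp add: borel_probs_def)
  show "(\<integral>x. \<phi> x \<partial>avg_pushforward f n) = (\<Sum>j=1..n. \<integral>x. \<phi> ((f ^^ j) x) \<partial>Lebesgue_circle) / n"
    if \<phi>: "continuous_on UNIV \<phi>" for \<phi> :: "circle \<Rightarrow> real"
  proof -
    obtain C where C: "\<And>x. \<bar>\<phi> x\<bar> \<le> C" using bounded_continuous_circle[OF \<phi>] by blast
    have m: "\<phi> \<in> borel_measurable borel" using \<phi> by (rule borel_measurable_continuous_onI)
    have "(\<integral>x. \<phi> x \<partial>avg_pushforward f n) = (\<integral>j. \<integral>x. \<phi> x \<partial>N j \<partial>measure_pmf p)"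
      unfolding bind
      using prob_space.emeasure_space_1[OF Np]
      by (intro integral_bind[OF m C Nk, where B'=1] measure_pmf.finite_measure_axioms) auto
    also have "\<dots> = (\<Sum>j=1..n. \<integral>x. \<phi> x \<partial>N j) / n"
      unfolding p_def by (subst integral_pmf_of_set[OF fin]) simp
    finally show ?thesis unfolding N_def by (simp add: integral_distr[OF fm m])
  qed
qed

lemma openin_weak_star_ball:
  assumes "continuous_on UNIV (\<phi> :: circle \<Rightarrow> real)"
  shows "openin weak_star {\<nu> \<in> borel_probs. \<bar>integral\<^sup>L \<nu> \<phi> - a\<bar> < e}"
proof -
  have "{\<nu> \<in> borel_probs. \<bar>integral\<^sup>L \<nu> \<phi> - a\<bar> < e} = {\<nu> \<in> borel_probs. integral\<^sup>L \<nu> \<phi> \<in> ball a e}"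
    by (auto simp: dist_real_def abs_minus_commute)
  then show ?thesis unfolding weak_star_def
    using assms by (intro topology_generated_by_Basis) blast
qed

text \<open>The Krylov-Bogolyubov argument: the integrals of \<phi> composed with f and of \<phi>
  against the k-th average differ by a telescoping sum over k, so by at most 1/k when \<phi> takes
  values in [0, 1].\<close>

lemma weak_star_limit_invariant:
  assumes f: "continuous_on UNIV f"
    and \<mu>: "\<And>n. n \<ge> 1 \<Longrightarrow> \<mu> \<in> weak_star closure_of {avg_pushforward f k |k. k \<ge> n}"
  shows "\<mu> \<in> invariant_probs f"
proof -
  interpret L: prob_space Lebesgue_circle by (rule prob_space_Lebesgue_circle)
  have \<mu>b: "\<mu> \<in> borel_probs"
    using \<mu>[of 1] closure_of_subset_topspace[of weak_star] by (auto simp: topspace_weak_star)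
  then interpret prob_space \<mu> by (simp add: borel_probs_def)
  have sets: "sets \<mu> = sets borel" using \<mu>b by (simp add: borel_probs_def)
  have fm: "f \<in> \<mu> \<rightarrow>\<^sub>M borel" unfolding measurable_cong_sets[OF sets refl]
    by (intro borel_measurable_continuous_onI f)
  have "distr \<mu> borel f = \<mu>"
  proof (rule prob_measure_eqI_continuous)
    fix \<phi> :: "circle \<Rightarrow> real" assume \<phi>: "continuous_on UNIV \<phi>" and bd: "\<And>x. \<phi> x \<in> {0..1}"
    have \<phi>f: "continuous_on UNIV (\<lambda>x. \<phi> (f x))"
      by (intro continuous_on_compose2[OF \<phi> f]) auto
    have "(\<integral>x. \<phi> (f x) \<partial>\<mu>) = (\<integral>x. \<phi> x \<partial>\<mu>)"
    proof (rule ccontr)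
      assume ne: "\<not> ?thesis"
      \<comment> \<open>A third of the gap: two thirds bound the passage from \<open>\<mu>\<close>
        to the average for the two test functions, and the telescoped difference is less than the
        last third.\<close>
      define e where "e = \<bar>(\<integral>x. \<phi> (f x) \<partial>\<mu>) - (\<integral>x. \<phi> x \<partial>\<mu>)\<bar> / 3"
      have e: "e > 0" using ne by (simp add: e_def)
      obtain n' where "1 / real (Suc n') < e" using nat_approx_posE[OF e] by blast
      then obtain n :: nat where n: "n > 0" "1 / n < e" by blast
      define T where "T = {\<nu> \<in> borel_probs. \<bar>integral\<^sup>L \<nu> \<phi> - integral\<^sup>L \<mu> \<phi>\<bar> < e} \<inter>
        {\<nu> \<in> borel_probs. \<bar>integral\<^sup>L \<nu> (\<lambda>x. \<phi> (f x)) - (\<integral>x. \<phi> (f x) \<partial>\<mu>)\<bar> < e}"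
      have "openin weak_star T" unfolding T_def
        by (intro openin_Int openin_weak_star_ball \<phi> \<phi>f)
      moreover have "\<mu> \<in> T" using \<mu>b e by (simp add: T_def)
      ultimately obtain k where k: "k \<ge> n" "avg_pushforward f k \<in> T"
        using \<mu>[of n] n unfolding in_closure_of by auto
      define a where "a j = (\<integral>x. \<phi> ((f ^^ j) x) \<partial>Lebesgue_circle)" for j
      have a: "0 \<le> a j" "a j \<le> 1" for j
      proof -
        have "integrable Lebesgue_circle (\<lambda>x. \<phi> ((f ^^ j) x))"
          using prob_space_Lebesgue_circle
          by (intro integrable_continuous_circle continuous_on_compose2[OF \<phi> continuous_on_funpow[OF f]])
             (auto simp: borel_probs_def Lebesgue_circle_def)
        then show "0 \<le> a j" "a j \<le> 1"
          unfolding a_def using bd by (auto intro!: Bochner_Integration.integral_nonneg L.integral_le_const)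
      qed
      have k0: "k > 0" using k n by simp
      have "(\<integral>x. \<phi> (f x) \<partial>avg_pushforward f k) - (\<integral>x. \<phi> x \<partial>avg_pushforward f k)
          = (\<Sum>j=1..k. a (Suc j) - a j) / k"
        by (simp add: integral_avg_pushforward[OF f k0] \<phi> \<phi>f a_def sum_subtractf diff_divide_distrib)
      also have "(\<Sum>j=1..k. a (Suc j) - a j) = a (Suc k) - a 1"
        using k0 by (subst sum_Suc_diff) auto
      finally have "\<bar>(\<integral>x. \<phi> (f x) \<partial>avg_pushforward f k) - (\<integral>x. \<phi> x \<partial>avg_pushforward f k)\<bar> = \<bar>a (Suc k) - a 1\<bar> / k"
        by simp
      also have "\<dots> \<le> 1 / k" using a[of "Suc k"] a[of 1] by (intro divide_right_mono) auto
      also have "\<dots> \<le> 1 / n" using k n by (intro divide_left_mono) auto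
      finally show False using k(2) n unfolding T_def e_def by (auto simp: abs_if split: if_splits)
    qed
    then show "(\<integral>x. \<phi> x \<partial>distr \<mu> borel f) = (\<integral>x. \<phi> x \<partial>\<mu>)"
      using \<phi> by (subst integral_distr[OF fm]) (auto intro: borel_measurable_continuous_onI)
  qed (use sets fm in \<open>auto intro: prob_space_distr prob_space_axioms\<close>)
  then show ?thesis using \<mu>b by (simp add: invariant_probs_def)
qed

text \<open>The generating sets are only a subbasis. Induction over the generated topology collects
  finitely many test functions, with the smaller tolerance at each intersection.\<close>

lemma weak_star_neighbourhood:
  assumes "openin weak_star U" "\<mu> \<in> U"
  obtains \<Phi> :: "(circle \<Rightarrow> real) set" and \<epsilon> where
    "finite \<Phi>" "\<forall>\<phi>\<in>\<Phi>. continuous_on UNIV \<phi>" "\<epsilon> > 0"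
    "\<forall>\<nu>\<in>borel_probs. (\<forall>\<phi>\<in>\<Phi>. \<bar>integral\<^sup>L \<nu> \<phi> - integral\<^sup>L \<mu> \<phi>\<bar> < \<epsilon>) \<longrightarrow> \<nu> \<in> U"
proof -
  have "\<exists>(\<Phi> :: (circle \<Rightarrow> real) set) \<epsilon>. finite \<Phi> \<and> (\<forall>\<phi>\<in>\<Phi>. continuous_on UNIV \<phi>) \<and> \<epsilon> > 0 \<and>
    (\<forall>\<nu>\<in>borel_probs. (\<forall>\<phi>\<in>\<Phi>. \<bar>integral\<^sup>L \<nu> \<phi> - integral\<^sup>L \<mu> \<phi>\<bar> < \<epsilon>) \<longrightarrow> \<nu> \<in> U)"
    using openin_topology_generated_by[OF assms(1)[unfolded weak_star_def]] assms(2)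
  proof (induction rule: generate_topology_on.induct)
    case (Int a b)
    have "\<mu> \<in> a" "\<mu> \<in> b" using \<open>\<mu> \<in> a \<inter> b\<close> by simp_all
    obtain \<Phi>1 :: "(circle \<Rightarrow> real) set" and \<epsilon>1 where 1: "finite \<Phi>1" "\<forall>\<phi>\<in>\<Phi>1. continuous_on UNIV \<phi>" "\<epsilon>1 > 0"
      "\<forall>\<nu>\<in>borel_probs. (\<forall>\<phi>\<in>\<Phi>1. \<bar>integral\<^sup>L \<nu> \<phi> - integral\<^sup>L \<mu> \<phi>\<bar> < \<epsilon>1) \<longrightarrow> \<nu> \<in> a"
      using Int.IH(1) \<open>\<mu> \<in> a\<close> by blast
    obtain \<Phi>2 :: "(circle \<Rightarrow> real) set" and \<epsilon>2 where 2: "finite \<Phi>2" "\<forall>\<phi>\<in>\<Phi>2. continuous_on UNIV \<phi>" "\<epsilon>2 > 0"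
      "\<forall>\<nu>\<in>borel_probs. (\<forall>\<phi>\<in>\<Phi>2. \<bar>integral\<^sup>L \<nu> \<phi> - integral\<^sup>L \<mu> \<phi>\<bar> < \<epsilon>2) \<longrightarrow> \<nu> \<in> b"
      using Int.IH(2) \<open>\<mu> \<in> b\<close> by blast
    show ?case
    proof (intro exI[of _ "\<Phi>1 \<union> \<Phi>2"] exI[of _ "min \<epsilon>1 \<epsilon>2"] conjI ballI impI)
      fix \<nu> assume \<nu>: "\<nu> \<in> borel_probs"
        "\<forall>\<phi>\<in>\<Phi>1 \<union> \<Phi>2. \<bar>integral\<^sup>L \<nu> \<phi> - integral\<^sup>L \<mu> \<phi>\<bar> < min \<epsilon>1 \<epsilon>2"
      have "\<nu> \<in> a" using 1(4) \<nu> by simp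
      moreover have "\<nu> \<in> b" using 2(4) \<nu> by simp
      ultimately show "\<nu> \<in> a \<inter> b" by simp
    qed (use 1 2 in auto)
  next
    case (UN K)
    obtain k where k: "k \<in> K" "\<mu> \<in> k" using \<open>\<mu> \<in> \<Union>K\<close> by (rule UnionE)
    obtain \<Phi> :: "(circle \<Rightarrow> real) set" and \<epsilon> where "finite \<Phi>" "\<forall>\<phi>\<in>\<Phi>. continuous_on UNIV \<phi>" "\<epsilon> > 0"
      "\<forall>\<nu>\<in>borel_probs. (\<forall>\<phi>\<in>\<Phi>. \<bar>integral\<^sup>L \<nu> \<phi> - integral\<^sup>L \<mu> \<phi>\<bar> < \<epsilon>) \<longrightarrow> \<nu> \<in> k"
      using UN(2)[OF k] by blast
    then show ?case using k(1) by (intro exI[of _ \<Phi>] exI[of _ \<epsilon>]) auto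
  next
    case (Basis s)
    from Basis(1) obtain \<phi> :: "circle \<Rightarrow> real" and V
      where s: "s = {\<mu> \<in> borel_probs. integral\<^sup>L \<mu> \<phi> \<in> V}" "continuous_on UNIV \<phi>" "open V"
      unfolding mem_Collect_eq by (elim exE conjE)
    have "integral\<^sup>L \<mu> \<phi> \<in> V" using Basis(2) s(1) by simp
    then obtain \<epsilon> where \<epsilon>: "\<epsilon> > 0" "ball (integral\<^sup>L \<mu> \<phi>) \<epsilon> \<subseteq> V"
      using s(3) open_contains_ball by blast
    show ?case
    proof (intro exI[of _ "{\<phi>}"] exI[of _ \<epsilon>] conjI ballI impI)
      fix \<nu> assume \<nu>: "\<nu> \<in> borel_probs" "\<forall>\<phi>\<in>{\<phi>}. \<bar>integral\<^sup>L \<nu> \<phi> - integral\<^sup>L \<mu> \<phi>\<bar> < \<epsilon>"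
      then have "integral\<^sup>L \<nu> \<phi> \<in> ball (integral\<^sup>L \<mu> \<phi>) \<epsilon>" by (simp add: dist_real_def abs_minus_commute)
      then show "\<nu> \<in> s" using s(1) \<epsilon>(2) \<nu>(1) by blast
    qed (use s(2) \<epsilon>(1) in simp_all)
  qed simp
  then show ?thesis using that by blast
qed

section \<open>Grid partitions of unity as a countable family of test functions\<close>

definition tent :: "nat \<Rightarrow> nat \<Rightarrow> circle \<Rightarrow> real" where
  "tent N i x = max 0 (2 / N - dist x (to_circle (i / N)))"

definition bump :: "nat \<Rightarrow> nat \<Rightarrow> circle \<Rightarrow> real" where
  "bump N i x = tent N i x / (\<Sum>j<N. tent N j x)"

lemma tent_nonneg: "tent N i x \<ge> 0" by (simp add: tent_def)

text \<open>The grid has mesh \<open>1 / N\<close>, so the grid point just below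
  \<open>frac a\<close> is within \<open>1 / N\<close> of \<open>x\<close>, well inside the radius
  \<open>2 / N\<close> of its tent.\<close>

lemma sum_tent_pos:
  assumes "N > 0"
  shows "(\<Sum>j<N. tent N j x) > 0"
proof -
  obtain a where a: "x = to_circle a" by (rule surj_to_circle)
  define j where "j = nat \<lfloor>N * frac a\<rfloor>"
  have f: "0 \<le> N * frac a" "N * frac a < N" using assms by (simp_all add: frac_lt_1)
  have "real j \<le> N * frac a" "N * frac a \<le> real j + 1" unfolding j_def using f(1) by linarith+
  then have "j / N \<le> frac a" "frac a \<le> (j + 1) / N"
    using assms by (simp_all add: divide_le_eq le_divide_eq mult.commute)
  then have "\<bar>frac a - j / N\<bar> \<le> 1 / N" by (simp add: add_divide_distrib)
  moreover have "x = to_circle (frac a)" using a by (simp add: frac_def to_circle_eq_iff)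
  ultimately have "dist x (to_circle (j / N)) \<le> 1 / N"
    using dist_to_circle_le[of "frac a" "j / N"] by (simp add: dist_real_def)
  moreover have "1 / N < 2 / N" using assms by (simp add: divide_strict_right_mono)
  ultimately have "tent N j x > 0" by (simp add: tent_def)
  moreover have "j < N" unfolding j_def using f by linarith
  ultimately show ?thesis by (intro sum_pos2[of _ j]) (auto simp: tent_nonneg)
qed

lemma continuous_tent: "continuous_on UNIV (tent N i)"
  unfolding tent_def by (intro continuous_intros)

lemma continuous_bump:
  assumes "N > 0"
  shows "continuous_on UNIV (bump N i)"
proof -
  have "(\<Sum>j<N. tent N j x) \<noteq> 0" for x
    using sum_tent_pos[OF assms, of x] by linarith
  then show ?thesis
    unfolding bump_def by (intro continuous_on_divide continuous_on_sum continuous_tent) blast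
qed

lemma sum_bump: "N > 0 \<Longrightarrow> (\<Sum>i<N. bump N i x) = 1"
  using sum_tent_pos[of N x] by (simp add: bump_def flip: sum_divide_distrib)

lemma bump_nonneg: "bump N i x \<ge> 0"
  by (simp add: bump_def tent_nonneg sum_nonneg)

lemma bump_range: "i < N \<Longrightarrow> bump N i x \<in> {0..1}"
  using sum_bump[of N x] member_le_sum[of i "{..<N}" "\<lambda>i. bump N i x"] bump_nonneg[of N _ x] by auto

text \<open>The bumps sum to one, so the error is a weighted mean of differences between \<phi> at
  \<open>x\<close> and at grid points, and weights vanish at grid points at distance
  \<open>2 / N\<close> or more.\<close>

lemma bump_approximation:
  fixes \<phi> :: "circle \<Rightarrow> real"
  assumes N: "N > 0" and \<phi>: "\<And>x y. dist x y < 2 / N \<Longrightarrow> \<bar>\<phi> x - \<phi> y\<bar> \<le> e"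
  shows "\<bar>\<phi> x - (\<Sum>i<N. \<phi> (to_circle (i / N)) * bump N i x)\<bar> \<le> e"
proof -
  have "\<phi> x - (\<Sum>i<N. \<phi> (to_circle (i / N)) * bump N i x)
      = (\<Sum>i<N. (\<phi> x - \<phi> (to_circle (i / N))) * bump N i x)"
    by (simp add: left_diff_distrib sum_subtractf sum_bump[OF N] flip: sum_distrib_left)
  also have "\<bar>\<dots>\<bar> \<le> (\<Sum>i<N. e * bump N i x)"
  proof (intro order_trans[OF sum_abs] sum_mono)
    fix i
    show "\<bar>(\<phi> x - \<phi> (to_circle (i / N))) * bump N i x\<bar> \<le> e * bump N i x"
    proof (cases "dist x (to_circle (i / N)) < 2 / N")
      case True
      then show ?thesis using \<phi> bump_nonneg[of N i x] by (simp add: abs_mult mult_right_mono)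
    next
      case False then show ?thesis by (simp add: bump_def tent_def)
    qed
  qed
  also have "\<dots> = e" by (simp add: sum_bump[OF N] flip: sum_distrib_left)
  finally show ?thesis .
qed

text \<open>Each of finitely many test functions is uniformly close to a combination of bumps whose
  coefficients do not depend on the measure. The approximation costs \<open>\<epsilon> / 4\<close>
  for each of the two measures, and the difference of the bump integrals another
  \<open>\<epsilon> / 4\<close>.\<close>

lemma weak_star_closure_bumpI:
  assumes \<mu>: "\<mu> \<in> borel_probs" and S: "S \<subseteq> borel_probs"
    and approx: "\<And>N \<epsilon>. N > 0 \<Longrightarrow> \<epsilon> > 0 \<Longrightarrow>
      \<exists>\<nu>\<in>S. \<forall>i<N. \<bar>integral\<^sup>L \<nu> (bump N i) - integral\<^sup>L \<mu> (bump N i)\<bar> < \<epsilon>"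
  shows "\<mu> \<in> weak_star closure_of S"
  unfolding in_closure_of
proof (intro conjI allI impI)
  show "\<mu> \<in> topspace weak_star" using \<mu> by (simp add: topspace_weak_star)
  fix U assume U: "\<mu> \<in> U \<and> openin weak_star U"
  obtain \<Phi> :: "(circle \<Rightarrow> real) set" and \<epsilon> where \<Phi>: "finite \<Phi>" "\<forall>\<phi>\<in>\<Phi>. continuous_on UNIV \<phi>" and \<epsilon>: "\<epsilon> > 0"
    and nb: "\<forall>\<nu>\<in>borel_probs. (\<forall>\<phi>\<in>\<Phi>. \<bar>integral\<^sup>L \<nu> \<phi> - integral\<^sup>L \<mu> \<phi>\<bar> < \<epsilon>) \<longrightarrow> \<nu> \<in> U"
    using weak_star_neighbourhood[OF conjunct2[OF U] conjunct1[OF U]] by blast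
  obtain d where d: "d > 0" "\<And>\<phi> x y. \<phi> \<in> \<Phi> \<Longrightarrow> dist x y < d \<Longrightarrow> dist (\<phi> x) (\<phi> y) < \<epsilon>/4"
    using uniform_continuity_circle_finite[of \<Phi> "\<lambda>\<phi>. \<phi>" "\<epsilon>/4"] \<Phi> \<epsilon> by auto
  obtain N' where "1 / real (Suc N') < d / 2" using nat_approx_posE[of "d / 2"] d(1) by auto
  then obtain N :: nat where "N > 0" "1 / N < d / 2" by blast
  then have N: "N > 0" "2 / N < d" by (simp_all add: field_simps)
  define I where "I \<nu> \<phi> = (\<Sum>i<N. \<phi> (to_circle (i / N)) * integral\<^sup>L \<nu> (bump N i))" for \<nu> and \<phi> :: "circle \<Rightarrow> real"
  have I: "\<bar>integral\<^sup>L \<nu> \<phi> - I \<nu> \<phi>\<bar> \<le> \<epsilon>/4" if \<nu>: "\<nu> \<in> borel_probs" and \<phi>: "\<phi> \<in> \<Phi>" for \<nu> \<phi>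
  proof -
    interpret prob_space \<nu> using \<nu> by (simp add: borel_probs_def)
    have ib: "integrable \<nu> (bump N i)" for i
      by (intro integrable_continuous_circle continuous_bump \<nu> N)
    have i\<phi>: "integrable \<nu> \<phi>" using \<Phi>(2) \<phi> by (intro integrable_continuous_circle \<nu>) blast
    have "integral\<^sup>L \<nu> \<phi> - I \<nu> \<phi> = (\<integral>x. \<phi> x - (\<Sum>i<N. \<phi> (to_circle (i / N)) * bump N i x) \<partial>\<nu>)"
      using ib i\<phi> by (simp add: I_def Bochner_Integration.integral_sum)
    moreover have "\<bar>\<integral>x. \<phi> x - (\<Sum>i<N. \<phi> (to_circle (i / N)) * bump N i x) \<partial>\<nu>\<bar>
        \<le> (\<integral>x. \<bar>\<phi> x - (\<Sum>i<N. \<phi> (to_circle (i / N)) * bump N i x)\<bar> \<partial>\<nu>)"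
      by (rule integral_abs_bound)
    moreover have "\<bar>\<phi> x - (\<Sum>i<N. \<phi> (to_circle (i / N)) * bump N i x)\<bar> \<le> \<epsilon>/4" for x
      using d(2)[OF \<phi>] N by (intro bump_approximation) (auto simp: dist_real_def less_imp_le)
    then have "(\<integral>x. \<bar>\<phi> x - (\<Sum>i<N. \<phi> (to_circle (i / N)) * bump N i x)\<bar> \<partial>\<nu>) \<le> \<epsilon>/4"
      using ib i\<phi> by (intro integral_le_const) auto
    ultimately show ?thesis by linarith
  qed
  \<comment> \<open>\<open>C\<close> bounds the absolute coefficient sums of all test functions at
    once; the summand 1 keeps it positive when they all vanish.\<close>
  define C where "C = 1 + (\<Sum>\<phi>\<in>\<Phi>. \<Sum>i<N. \<bar>\<phi> (to_circle (i / N))\<bar>)"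
  have C: "C > 0" "\<And>\<phi>. \<phi> \<in> \<Phi> \<Longrightarrow> (\<Sum>i<N. \<bar>\<phi> (to_circle (i / N))\<bar>) \<le> C"
  proof -
    show "C > 0" unfolding C_def by (intro add_pos_nonneg sum_nonneg) auto
    fix \<phi> assume "\<phi> \<in> \<Phi>"
    then have "(\<Sum>i<N. \<bar>\<phi> (to_circle (i / N))\<bar>) \<le> (\<Sum>\<phi>\<in>\<Phi>. \<Sum>i<N. \<bar>\<phi> (to_circle (i / N))\<bar>)"
      using \<Phi>(1) by (intro member_le_sum[of \<phi> \<Phi> "\<lambda>\<phi>. \<Sum>i<N. \<bar>\<phi> (to_circle (i / N))\<bar>"]) (auto intro: sum_nonneg)
    then show "(\<Sum>i<N. \<bar>\<phi> (to_circle (i / N))\<bar>) \<le> C" by (simp add: C_def)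
  qed
  have "\<epsilon> / (4 * C) > 0" using \<epsilon> C by simp
  from approx[OF N(1) this] obtain \<nu> where \<nu>: "\<nu> \<in> S"
    "\<And>i. i < N \<Longrightarrow> \<bar>integral\<^sup>L \<nu> (bump N i) - integral\<^sup>L \<mu> (bump N i)\<bar> < \<epsilon> / (4 * C)" by blast
  have "\<nu> \<in> U"
  proof (rule nb[rule_format])
    show \<nu>b: "\<nu> \<in> borel_probs" using \<nu> S by blast
    fix \<phi> assume \<phi>: "\<phi> \<in> \<Phi>"
    have "\<bar>I \<nu> \<phi> - I \<mu> \<phi>\<bar> = \<bar>\<Sum>i<N. \<phi> (to_circle (i / N)) * (integral\<^sup>L \<nu> (bump N i) - integral\<^sup>L \<mu> (bump N i))\<bar>"
      by (simp add: I_def sum_subtractf right_diff_distrib)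
    also have "\<dots> \<le> (\<Sum>i<N. \<bar>\<phi> (to_circle (i / N))\<bar> * (\<epsilon> / (4 * C)))"
    proof (intro order_trans[OF sum_abs] sum_mono)
      fix i assume "i \<in> {..<N}"
      then have "\<bar>integral\<^sup>L \<nu> (bump N i) - integral\<^sup>L \<mu> (bump N i)\<bar> \<le> \<epsilon> / (4 * C)"
        using \<nu>(2)[of i] by simp
      then show "\<bar>\<phi> (to_circle (i / N)) * (integral\<^sup>L \<nu> (bump N i) - integral\<^sup>L \<mu> (bump N i))\<bar>
          \<le> \<bar>\<phi> (to_circle (i / N))\<bar> * (\<epsilon> / (4 * C))"
        unfolding abs_mult by (rule mult_left_mono) simp
    qed
    also have "\<dots> = (\<Sum>i<N. \<bar>\<phi> (to_circle (i / N))\<bar>) * (\<epsilon> / (4 * C))" by (simp only: sum_distrib_right)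
    also have "\<dots> \<le> C * (\<epsilon> / (4 * C))" using C(2)[OF \<phi>] \<epsilon> C(1) by (intro mult_right_mono) auto
    also have "\<dots> = \<epsilon> / 4" using C(1) by simp
    finally show "\<bar>integral\<^sup>L \<nu> \<phi> - integral\<^sup>L \<mu> \<phi>\<bar> < \<epsilon>"
      using I[OF \<nu>b \<phi>] I[OF \<mu> \<phi>] \<epsilon> by linarith
  qed
  then show "\<exists>y. y \<in> S \<and> y \<in> U" using \<nu> by blast
qed

section \<open>Open dense sets of maps\<close>

lemma open_dense_splitting:
  assumes "openin X B"
  shows "openin X (B \<union> (topspace X - X closure_of B))"
    and "X closure_of (B \<union> (topspace X - X closure_of B)) = topspace X"
proof -
  show "openin X (B \<union> (topspace X - X closure_of B))"
    by (intro openin_Un assms openin_diff) auto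
  have "topspace X - X closure_of B \<subseteq> X closure_of (topspace X - X closure_of B)"
    by (rule closure_of_subset) auto
  then show "X closure_of (B \<union> (topspace X - X closure_of B)) = topspace X"
    using closure_of_subset_topspace[of X] by (auto simp: closure_of_Un)
qed

text \<open>The induction step compares both sides with the limit map at the moving point: the
  supremum distance controls one part, continuity of the limit map the other.\<close>

lemma tendsto_apply_bcontfun_funpow:
  fixes F :: "nat \<Rightarrow> ('a :: metric_space \<Rightarrow>\<^sub>C 'a)"
  assumes F: "F \<longlonglongrightarrow> f"
  shows "(\<lambda>m. (apply_bcontfun (F m) ^^ j) y) \<longlonglongrightarrow> (apply_bcontfun f ^^ j) y"
proof (induction j)
  case (Suc j)
  define a where "a m = (apply_bcontfun (F m) ^^ j) y" for m
  define b where "b = (apply_bcontfun f ^^ j) y"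
  have "continuous_on UNIV (apply_bcontfun f)" by (intro continuous_on_apply_bcontfun)
  then have "isCont (apply_bcontfun f) b" by (simp only: continuous_on_eq_continuous_at open_UNIV ball_UNIV)
  then have 1: "(\<lambda>m. dist (apply_bcontfun f (a m)) (apply_bcontfun f b)) \<longlonglongrightarrow> 0"
    using Suc unfolding a_def[symmetric] b_def[symmetric]
    by (subst tendsto_dist_iff[symmetric]) (rule isCont_tendsto_compose)
  have "(\<lambda>m. dist (F m) f) \<longlonglongrightarrow> 0" using F by (rule tendsto_dist_iff[THEN iffD1])
  from tendsto_add[OF this 1]
  have 2: "(\<lambda>m. dist (F m) f + dist (apply_bcontfun f (a m)) (apply_bcontfun f b)) \<longlonglongrightarrow> 0" by simp
  have "dist (apply_bcontfun (F m) (a m)) (apply_bcontfun f b)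
      \<le> dist (F m) f + dist (apply_bcontfun f (a m)) (apply_bcontfun f b)" for m
    using dist_triangle[of "apply_bcontfun (F m) (a m)" "apply_bcontfun f b" "apply_bcontfun f (a m)"]
      dist_bounded[of "F m" "a m" f] by linarith
  then have "(\<lambda>m. dist (apply_bcontfun (F m) (a m)) (apply_bcontfun f b)) \<longlonglongrightarrow> 0"
    by (intro Lim_null_comparison[OF _ 2]) auto
  then show ?case by (subst tendsto_dist_iff) (simp add: a_def b_def)
qed simp

lemma Lebesgue_circle_in_borel_probs: "Lebesgue_circle \<in> borel_probs"
  using prob_space_Lebesgue_circle by (simp add: borel_probs_def Lebesgue_circle_def)

text \<open>Iterates of convergent maps converge pointwise, and dominated convergence passes this to
  the integrals. This is what makes the target conditions open.\<close>

lemma continuous_integral_avg_pushforward: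
  fixes \<phi> :: "circle \<Rightarrow> real"
  assumes \<phi>: "continuous_on UNIV \<phi>" and n: "n > 0"
  shows "continuous_on UNIV (\<lambda>f. \<integral>x. \<phi> x \<partial>avg_pushforward (apply_bcontfun f) n)"
proof -
  interpret L: prob_space Lebesgue_circle by (rule prob_space_Lebesgue_circle)
  obtain C where C: "C > 0" "\<And>x. \<bar>\<phi> x\<bar> \<le> C" using bounded_continuous_circle[OF \<phi>] by blast
  have cf: "continuous_on UNIV (\<lambda>x. \<phi> ((apply_bcontfun f ^^ j) x))" for f :: "circle \<Rightarrow>\<^sub>C circle" and j
    by (intro continuous_on_compose2[OF \<phi> continuous_on_funpow] continuous_on_apply_bcontfun) auto
  have "(\<lambda>m. \<integral>x. \<phi> ((apply_bcontfun (F m) ^^ j) x) \<partial>Lebesgue_circle)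
      \<longlonglongrightarrow> (\<integral>x. \<phi> ((apply_bcontfun f ^^ j) x) \<partial>Lebesgue_circle)"
    if F: "F \<longlonglongrightarrow> f" for F :: "nat \<Rightarrow> circle \<Rightarrow>\<^sub>C circle" and f j
  proof (rule integral_dominated_convergence[where w="\<lambda>_. C"])
    show "AE x in Lebesgue_circle. (\<lambda>m. \<phi> ((apply_bcontfun (F m) ^^ j) x)) \<longlonglongrightarrow> \<phi> ((apply_bcontfun f ^^ j) x)"
      using \<phi> by (intro AE_I2 isCont_tendsto_compose[OF _ tendsto_apply_bcontfun_funpow[OF F]])
        (auto simp: continuous_on_eq_continuous_at)
  qed (use C borel_measurable_integrable[OF integrable_continuous_circle[OF Lebesgue_circle_in_borel_probs cf]]
      in auto)
  then have "(\<lambda>m. \<integral>x. \<phi> x \<partial>avg_pushforward (apply_bcontfun (F m)) n)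
      \<longlonglongrightarrow> (\<integral>x. \<phi> x \<partial>avg_pushforward (apply_bcontfun f) n)"
    if F: "F \<longlonglongrightarrow> f" for F :: "nat \<Rightarrow> circle \<Rightarrow>\<^sub>C circle" and f
    using that n
    by (simp add: integral_avg_pushforward[OF continuous_on_apply_bcontfun n \<phi>])
       (intro tendsto_intros; simp)
  then show ?thesis
    by (simp add: continuous_on_eq_continuous_at continuous_at_sequentially o_def)
qed

text \<open>Only the values of \<open>r\<close> below \<open>N\<close> enter, so a finite list can
  encode a target. The condition \<open>n > 0\<close> excludes the degenerate average without terms
  when \<open>l\<close> is 0.\<close>

definition bump_target :: "nat \<Rightarrow> (nat \<Rightarrow> real) \<Rightarrow> nat \<Rightarrow> real \<Rightarrow> (circle \<Rightarrow>\<^sub>C circle) set" where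
  "bump_target N r l \<eta> = {f \<in> CE. \<exists>n\<ge>l. n > 0 \<and>
     (\<forall>i<N. \<bar>integral\<^sup>L (avg_pushforward (apply_bcontfun f) n) (bump N i) - r i\<bar> < \<eta>)}"

lemma openin_bump_target: "openin (top_of_set CE) (bump_target N r l \<eta>)"
proof -
  define V where "V n i = {f. \<bar>integral\<^sup>L (avg_pushforward (apply_bcontfun f) n) (bump N i) - r i\<bar> < \<eta>}" for n i
  have "open (V n i)" if "n > 0" "i < N" for n i
    unfolding V_def using that
    by (intro open_Collect_less continuous_intros continuous_integral_avg_pushforward continuous_bump) auto
  then have "open (\<Inter>i\<in>{..<N}. V n i)" if "n > 0" for n
    using that by (intro open_INT) auto
  then have "open (\<Union>n\<in>{n. n \<ge> l \<and> n > 0}. \<Inter>i\<in>{..<N}. V n i)" by (intro open_UN) auto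
  moreover have "bump_target N r l \<eta> = CE \<inter> (\<Union>n\<in>{n. n \<ge> l \<and> n > 0}. \<Inter>i\<in>{..<N}. V n i)"
    by (auto simp: bump_target_def V_def)
  ultimately show ?thesis by (simp add: openin_open_Int)
qed

section \<open>Perturbation by staircase conjugacies\<close>

text \<open>A continuous version of the floor function: constant on [m, m + 1 - \<eta>] for each
  integer m, then rising to m + 1 with slope 1 / \<eta>. Weighted translates of it build step-like
  maps with prescribed values.\<close>

definition staircase :: "real \<Rightarrow> real \<Rightarrow> real" where
  "staircase \<eta> x = \<lfloor>x\<rfloor> + max 0 (1 - (1 - frac x) / \<eta>)"

context
  fixes \<eta> :: real
  assumes \<eta>: "0 < \<eta>" "\<eta> < 1"
begin

lemma staircase_add_one: "staircase \<eta> (x + 1) = staircase \<eta> x + 1"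
  by (simp add: staircase_def frac_def)

lemma staircase_flat: "frac x \<le> 1 - \<eta> \<Longrightarrow> staircase \<eta> x = \<lfloor>x\<rfloor>"
  using \<eta> by (simp add: staircase_def field_simps)

lemma staircase_bounds: "\<lfloor>x\<rfloor> \<le> staircase \<eta> x" "staircase \<eta> x \<le> \<lfloor>x\<rfloor> + 1" "staircase \<eta> x \<le> x"
proof -
  show "\<lfloor>x\<rfloor> \<le> staircase \<eta> x" by (simp add: staircase_def)
  have f: "0 \<le> frac x" "frac x < 1" by (simp_all add: frac_lt_1)
  show "staircase \<eta> x \<le> \<lfloor>x\<rfloor> + 1" using \<eta> f by (simp add: staircase_def)
  have "1 - frac x \<le> (1 - frac x) / \<eta>" using \<eta> f by (simp add: le_divide_eq mult_left_le)
  then have "staircase \<eta> x \<le> \<lfloor>x\<rfloor> + frac x" using f by (simp add: staircase_def)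
  then show "staircase \<eta> x \<le> x" by (simp add: frac_def)
qed

lemma mono_staircase: "mono (staircase \<eta>)"
proof (rule monoI)
  fix x y :: real assume xy: "x \<le> y"
  show "staircase \<eta> x \<le> staircase \<eta> y"
  proof (cases "\<lfloor>x\<rfloor> = \<lfloor>y\<rfloor>")
    case True
    then have "(1 - frac y) / \<eta> \<le> (1 - frac x) / \<eta>" using xy \<eta> by (intro divide_right_mono) (auto simp: frac_def)
    then show ?thesis using True by (simp add: staircase_def)
  next
    case False
    then have "\<lfloor>x\<rfloor> + 1 \<le> \<lfloor>y\<rfloor>" using xy floor_mono[OF xy] by linarith
    then show ?thesis using staircase_bounds(2)[of x] staircase_bounds(1)[of y] by linarith
  qed
qed

text \<open>Between consecutive integers the slope is at most \<open>1 / \<eta>\<close>. Otherwise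
  the interval is split at the integer \<open>c\<close> following \<open>x\<close>; beyond
  \<open>c\<close> the function lies below the identity, whose slope 1 is below
  \<open>1 / \<eta>\<close>.\<close>

lemma staircase_increment: "x \<le> y \<Longrightarrow> staircase \<eta> y - staircase \<eta> x \<le> (y - x) / \<eta>"
proof (cases "\<lfloor>x\<rfloor> = \<lfloor>y\<rfloor>")
  case True
  assume "x \<le> y"
  moreover have "(1 - frac x) / \<eta> - (1 - frac y) / \<eta> = (y - x) / \<eta>"
    using True by (simp add: frac_def flip: diff_divide_distrib)
  moreover have "(y - x) / \<eta> \<ge> 0" using \<open>x \<le> y\<close> \<eta> by simp
  ultimately show ?thesis using True by (simp add: staircase_def max_def)
next
  case False
  assume xy: "x \<le> y"
  define c where "c = real_of_int \<lfloor>x\<rfloor> + 1"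
  have c: "x \<le> c" "c \<le> y"
    using False floor_mono[OF xy] unfolding c_def by linarith+
  have "staircase \<eta> x \<ge> \<lfloor>x\<rfloor> + (1 - (1 - frac x) / \<eta>)" by (simp add: staircase_def)
  also have "1 - frac x = c - x" by (simp add: c_def frac_def)
  finally have "c - staircase \<eta> x \<le> (c - x) / \<eta>" by (simp add: c_def)
  moreover have "staircase \<eta> y - c \<le> (y - c) / \<eta>"
  proof -
    have "y - c \<le> (y - c) / \<eta>" using \<eta> c by (simp add: le_divide_eq mult_left_le)
    then show ?thesis using staircase_bounds(3)[of y] by linarith
  qed
  moreover have "(y - x) / \<eta> = (c - x) / \<eta> + (y - c) / \<eta>" by (simp flip: add_divide_distrib)
  ultimately show ?thesis by linarith
qed

lemma continuous_staircase: "continuous_on UNIV (staircase \<eta>)"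
proof (rule lipschitz_on_continuous_on[of "1 / \<eta>"], rule lipschitz_onI)
  fix x y
  show "dist (staircase \<eta> x) (staircase \<eta> y) \<le> 1 / \<eta> * dist x y"
    using staircase_increment[of x y] staircase_increment[of y x] monoD[OF mono_staircase, of x y]
      monoD[OF mono_staircase, of y x]
    by (cases "x \<le> y") (auto simp: dist_real_def)
qed (use \<eta> in auto)

end

text \<open>\<open>K\<close> will be a lift of the inverse of the expanding homeomorphism: it
  squeezes each arc, up to a final piece of length \<open>\<eta>\<close>, into the
  \<open>r\<close>-neighbourhood of \<open>p j\<close>. The bound \<open>2 / M\<close>, free of
  \<open>r\<close>, holds because \<open>S\<close> sends each arc into the union of itself and the
  next one.\<close>

lemma near_identity_lift:
  fixes p :: "nat \<Rightarrow> real" and M :: nat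
  assumes M: "M > 0" and p: "\<And>j. j < M \<Longrightarrow> j / M \<le> p j" "\<And>j. j < M \<Longrightarrow> p j \<le> (real j + 1) / M"
    and r: "r > 0" and \<eta>: "0 < \<eta>" "\<eta> < 1" "\<eta> \<le> 1 / M"
  obtains K where "degree_one_lift K" "\<And>x. \<bar>K x - x\<bar> \<le> 2 / M"
    "\<And>j x. j < M \<Longrightarrow> j / M \<le> x \<Longrightarrow> x \<le> (real j + 1) / M - \<eta> \<Longrightarrow> \<bar>K x - p j\<bar> < r"
proof -
  \<comment> \<open>Index \<open>M\<close> stands for index 0 after a full turn, so the increments
    of \<open>q\<close> add up to 1.\<close>
  define q where "q i = (if i < M then p i else p 0 + 1)" for i
  \<comment> \<open>\<open>S\<close> has degree one and equals \<open>p j\<close> on most of the \<open>j\<close>-th arc; adding a small multiple of the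
    identity makes it strictly increasing.\<close>
  define S where "S x = q 0 + (\<Sum>i<M. (q (Suc i) - q i) * staircase \<eta> (x - (real i + 1) / M + 1))" for x
  have q: "q i \<le> q (Suc i)" if "i < M" for i
  proof (cases "Suc i < M")
    case True then show ?thesis using p(2)[of i] p(1)[of "Suc i"] by (simp add: q_def add.commute)
  next
    case False
    then have "real i + 1 = M" using that by simp
    then have "(real i + 1) / M = 1" using M by simp
    then have "p i \<le> 1" using p(2)[OF that] by linarith
    then show ?thesis using p(1)[of 0] False that M by (simp add: q_def)
  qed
  have tele: "(\<Sum>i<m. q (Suc i) - q i) = q m - q 0" for m by (rule sum_lessThan_telescope)
  have contS: "continuous_on UNIV S" unfolding S_def
    by (intro continuous_intros continuous_on_compose2[OF continuous_staircase[OF \<eta>(1,2)]]) auto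
  have monoS: "S x \<le> S y" if "x \<le> y" for x y
    unfolding S_def using q that
    by (intro add_left_mono sum_mono mult_left_mono monoD[OF mono_staircase[OF \<eta>(1,2)]]) auto
  have shiftS: "S (x + 1) = S x + 1" for x
  proof -
    have "staircase \<eta> (x + 1 - (real i + 1) / M + 1) = staircase \<eta> (x - (real i + 1) / M + 1) + 1" for i :: nat
      using staircase_add_one[OF \<eta>(1,2), of "x - (real i + 1) / M + 1"] by (simp add: algebra_simps)
    then have "S (x + 1) = S x + (\<Sum>i<M. q (Suc i) - q i)"
      by (simp add: S_def algebra_simps sum.distrib sum_subtractf)
    then show ?thesis using M by (simp add: tele) (simp add: q_def)
  qed
  have flat: "S x = p j" if j: "j < M" and x: "j / M \<le> x" "x \<le> (real j + 1) / M - \<eta>" for j :: nat and x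
  proof -
    \<comment> \<open>The \<open>i\<close>-th staircase rises just before
      \<open>(real i + 1) / M\<close>; on the flat part of the \<open>j\<close>-th arc exactly those
      with \<open>i < j\<close> have completed this step.\<close>
    have "staircase \<eta> (x - (real i + 1) / M + 1) = of_bool (i < j)" if i: "i < M" for i :: nat
    proof (cases "i < j")
      case True
      define u where "u = x - (real i + 1) / M + 1"
      have "(real i + 1) / M \<le> j / M" using True by (intro divide_right_mono) auto
      then have u1: "1 \<le> u" using x by (simp add: u_def)
      have "(real j + 1) / M - (real i + 1) / M \<le> 1"
        using j M by (simp add: divide_le_eq flip: diff_divide_distrib)
      then have u2: "u \<le> 2 - \<eta>" using x by (simp add: u_def)
      have "\<lfloor>u\<rfloor> = 1" using u1 u2 \<eta> by (simp add: floor_eq_iff)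
      then show ?thesis using True u2 staircase_flat[OF \<eta>(1,2), of u]
        by (simp add: frac_def flip: u_def)
    next
      case False
      define u where "u = x - (real i + 1) / M + 1"
      have "(real j + 1) / M \<le> (real i + 1) / M" using False by (intro divide_right_mono) auto
      then have u1: "u \<le> 1 - \<eta>" using x by (simp add: u_def)
      have "(real i + 1) / M \<le> 1" using i by (simp add: divide_le_eq)
      moreover have "0 \<le> real j / M" by simp
      ultimately have u2: "0 \<le> u" using x unfolding u_def by linarith
      have "\<lfloor>u\<rfloor> = 0" using u1 u2 \<eta> by (simp add: floor_eq_iff)
      then show ?thesis using False u1 staircase_flat[OF \<eta>(1,2), of u]
        by (simp add: frac_def flip: u_def)
    qed
    then have "S x = q 0 + (\<Sum>i<M. (q (Suc i) - q i) * of_bool (i < j))" by (simp add: S_def)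
    also have "(\<Sum>i<M. (q (Suc i) - q i) * of_bool (i < j)) = (\<Sum>i<j. q (Suc i) - q i)"
      using j by (intro sum.mono_neutral_cong_right) auto
    finally show ?thesis using j by (simp add: tele) (simp add: q_def)
  qed
  have near: "\<bar>S x - x\<bar> \<le> 2 / M" if x: "0 \<le> x" "x < 1" for x
  proof -
    define j where "j = nat \<lfloor>M * x\<rfloor>"
    have Mx: "0 \<le> M * x" "M * x < M" using x M by simp_all
    have j: "j < M" unfolding j_def using Mx by linarith
    have "real j \<le> M * x" "M * x \<le> real j + 1" unfolding j_def using Mx(1) by linarith+
    then have jx: "j / M \<le> x" "x \<le> (real j + 1) / M"
      using M by (simp_all add: divide_le_eq le_divide_eq mult.commute)
    have "S (j / M) = p j" using \<eta> by (intro flat j) (auto simp: add_divide_distrib)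
    then have 1: "j / M \<le> S x" using p(1)[OF j] monoS[OF jx(1)] by simp
    have "S ((real j + 1) / M) \<le> (real j + 2) / M"
    proof (cases "j + 1 < M")
      case True
      have "S (real (j + 1) / M) = p (j + 1)"
        using \<eta> by (intro flat True) (auto simp: add_divide_distrib)
      then show ?thesis using p(2)[OF True] by (simp add: add.commute)
    next
      \<comment> \<open>After the last arc comes the first one, a full turn later, so
        \<open>shiftS\<close> supplies the value at its left end.\<close>
      case False
      then have jM: "real j + 1 = M" using j by simp
      have "S 0 = p 0" using \<eta> by (intro flat M) (auto simp: add_divide_distrib)
      then have "S 1 = p 0 + 1" using shiftS[of 0] by simp
      moreover have "(real j + 2) / M = 1 + 1 / M" using M jM by (simp add: field_simps)
      ultimately show ?thesis using p(2)[OF M] jM M by simp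
    qed
    then have "S x \<le> (real j + 2) / M" using monoS[OF jx(2)] by linarith
    then show ?thesis using 1 jx by (simp add: abs_le_iff add_divide_distrib)
  qed
  \<comment> \<open>A positive weight of the identity gives strict monotonicity. Being below
    \<open>r\<close> suffices for closeness, because on the flat parts \<open>K x - p j\<close> is
    \<open>\<tau> * (x - p j)\<close> with both points in the unit interval.\<close>
  define \<tau> where "\<tau> = min (1 / 2) (r / 2)"
  have \<tau>: "0 < \<tau>" "\<tau> < 1" "\<tau> < r" using r by (auto simp: \<tau>_def min_def)
  define K where "K x = \<tau> * x + (1 - \<tau>) * S x" for x
  have K: "degree_one_lift K"
  proof
    show "continuous_on UNIV K" unfolding K_def by (intro continuous_intros contS)
    show "strict_mono K"
    proof (rule strict_monoI)
      fix x y :: real assume "x < y"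
      then show "K x < K y" unfolding K_def using \<tau> monoS[of x y]
        by (intro add_less_le_mono mult_left_mono mult_strict_left_mono) auto
    qed
    show "K (x + 1) = K x + 1" for x unfolding K_def shiftS by (simp add: algebra_simps)
  qed
  have K1: "\<bar>K x - x\<bar> \<le> 2 / M" for x
  proof -
    interpret degree_one_lift K by (rule K)
    define y where "y = frac x"
    have y: "0 \<le> y" "y < 1" by (simp_all add: y_def frac_lt_1)
    have "K (y + \<lfloor>x\<rfloor>) = K y + \<lfloor>x\<rfloor>" by (rule shift_int) simp
    then have "K x - x = K y - y" by (simp add: y_def frac_def)
    also have "\<dots> = (1 - \<tau>) * (S y - y)" by (simp add: K_def algebra_simps)
    finally have "\<bar>K x - x\<bar> = (1 - \<tau>) * \<bar>S y - y\<bar>" using \<tau> by (simp add: abs_mult)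
    also have "\<dots> \<le> 1 * \<bar>S y - y\<bar>" using \<tau> by (intro mult_right_mono) auto
    finally show ?thesis using near[OF y] by simp
  qed
  have K2: "\<bar>K x - p j\<bar> < r" if j: "j < M" and x: "j / M \<le> x" "x \<le> (real j + 1) / M - \<eta>" for j :: nat and x
  proof -
    have "(real j + 1) / M \<le> 1" using j by (simp add: divide_le_eq)
    moreover have "0 \<le> real j / M" by simp
    ultimately have "\<bar>x - p j\<bar> \<le> 1" using x p[OF j] \<eta> by linarith
    moreover have "K x - p j = \<tau> * (x - p j)" by (simp add: K_def flat[OF j x] algebra_simps)
    ultimately have "\<bar>K x - p j\<bar> \<le> \<tau>" using \<tau> by (simp add: abs_mult mult_left_le)
    then show ?thesis using \<tau> by linarith
  qed
  show ?thesis using that[OF K K1 K2] by blast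
qed

text \<open>The deviation exceeds \<open>c\<close> at most on \<open>M\<close> gaps of length
  \<open>\<eta>\<close> at the right ends of the arcs. There it is at most 1, which contributes no
  more than \<open>M * \<eta>\<close>.\<close>

lemma Lebesgue_circle_integral_near:
  fixes F :: "circle \<Rightarrow> real" and M :: nat and a c \<eta> :: real
  assumes F: "continuous_on UNIV F" and M: "M > 0" and \<eta>: "0 < \<eta>" "\<eta> \<le> 1 / M" and c: "0 \<le> c"
    and bd: "\<And>x. \<bar>F x - a\<bar> \<le> 1"
    and near: "\<And>j x. j < M \<Longrightarrow> j / M \<le> x \<Longrightarrow> x \<le> (real j + 1) / M - \<eta> \<Longrightarrow> \<bar>F (to_circle x) - a\<bar> \<le> c"
  shows "\<bar>(\<integral>x. F x \<partial>Lebesgue_circle) - a\<bar> \<le> c + M * \<eta>"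
proof -
  define P where "P = restrict_space (lborel :: real measure) {0..<1}"
  have P: "prob_space P"
    unfolding P_def by (intro prob_spaceI) (simp add: space_restrict_space emeasure_restrict_space)
  interpret prob_space P by (rule P)
  have spaceP: "space P = {0..<1}" by (simp add: P_def space_restrict_space)
  have tc: "to_circle \<in> P \<rightarrow>\<^sub>M borel" unfolding P_def by (intro measurable_restrict_space1) simp
  have Fm: "F \<in> borel_measurable borel" using F by (rule borel_measurable_continuous_onI)
  have Fi: "integrable P (\<lambda>x. F (to_circle x))"
  proof (rule integrable_const_bound[where B="\<bar>a\<bar> + 1"])
    show "AE x in P. norm (F (to_circle x)) \<le> \<bar>a\<bar> + 1"
    proof (rule AE_I2)
      fix x show "norm (F (to_circle x)) \<le> \<bar>a\<bar> + 1" using bd[of "to_circle x"] unfolding real_norm_def by linarith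
    qed
    show "(\<lambda>x. F (to_circle x)) \<in> borel_measurable P" by (rule measurable_compose[OF tc Fm])
  qed
  define B where "B j = {(real j + 1) / M - \<eta><..<(real j + 1) / M}" for j :: nat
  have Bsub: "B j \<subseteq> {0..<1}" if "j < M" for j
  proof -
    have "(real j + 1) / M \<le> 1" using that by (simp add: divide_le_eq)
    moreover have "0 \<le> (real j + 1) / M - \<eta>" using \<eta> by (simp add: add_divide_distrib add_increasing)
    ultimately show ?thesis by (auto simp: B_def)
  qed
  have Bm: "B j \<in> sets P" "measure P (B j) = \<eta>" if "j < M" for j
  proof -
    show "B j \<in> sets P" unfolding P_def using Bsub[OF that]
      by (subst sets_restrict_space_iff) (auto simp: B_def)
    show "measure P (B j) = \<eta>" unfolding P_def using Bsub[OF that] \<eta>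
      by (subst measure_restrict_space) (auto simp: B_def)
  qed
  have Bi: "integrable P (\<lambda>x. c + (\<Sum>j<M. indicator (B j) x))"
    using Bm by (intro Bochner_Integration.integrable_add Bochner_Integration.integrable_sum)
      (auto intro!: integrable_real_indicator simp: emeasure_eq_measure)
  have "(\<integral>x. F x \<partial>Lebesgue_circle) = (\<integral>x. F (to_circle x) \<partial>P)"
    unfolding Lebesgue_circle_def P_def[symmetric] by (rule integral_distr[OF tc Fm])
  then have "(\<integral>x. F x \<partial>Lebesgue_circle) - a = (\<integral>x. F (to_circle x) - a \<partial>P)"
    using Fi by (simp add: prob_space)
  also have "\<bar>\<dots>\<bar> \<le> (\<integral>x. \<bar>F (to_circle x) - a\<bar> \<partial>P)" by (rule integral_abs_bound)
  also have "\<dots> \<le> (\<integral>x. c + (\<Sum>j<M. indicator (B j) x) \<partial>P)"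
  proof (rule integral_mono)
    fix x assume "x \<in> space P"
    then have x: "0 \<le> x" "x < 1" by (auto simp: spaceP)
    define j where "j = nat \<lfloor>M * x\<rfloor>"
    have Mx: "0 \<le> M * x" "M * x < M" using x M by simp_all
    have j: "j < M" unfolding j_def using Mx by linarith
    have "real j \<le> M * x" "M * x < real j + 1" unfolding j_def using Mx(1) by linarith+
    then have jx: "j / M \<le> x" "x < (real j + 1) / M"
      using M by (simp_all add: divide_le_eq less_divide_eq mult.commute)
    show "\<bar>F (to_circle x) - a\<bar> \<le> c + (\<Sum>j<M. indicator (B j) x)"
    proof (cases "x \<le> (real j + 1) / M - \<eta>")
      case True
      have "0 \<le> (\<Sum>j<M. indicator (B j) x :: real)" by (intro sum_nonneg) auto
      then show ?thesis using near[OF j jx(1) True] by linarith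
    next
      case False
      then have "x \<in> B j" using jx by (simp add: B_def)
      then have "1 = (indicator (B j) x :: real)" by simp
      also have "\<dots> \<le> (\<Sum>j<M. indicator (B j) x)" using j by (intro member_le_sum) auto
      finally show ?thesis using bd[of "to_circle x"] c by linarith
    qed
  qed (use Fi Bi in auto)
  also have "\<dots> = c + M * \<eta>"
    using Bm by (subst Bochner_Integration.integral_add)
      (auto intro!: Bochner_Integration.integrable_sum integrable_real_indicator
        simp: emeasure_eq_measure prob_space Bochner_Integration.integral_sum)
  finally show ?thesis .
qed

lemma funpow_conjugate:
  assumes "\<And>x. g (g' x) = x" "\<And>x. g' (g x) = x"
  shows "(g \<circ> f \<circ> g') ^^ j = g \<circ> (f ^^ j) \<circ> g'"
  by (induction j) (auto simp: assms fun_eq_iff)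

text \<open>The error against \<open>\<mu>\<close> consists of \<open>\<epsilon> / 4\<close> for the
  averages at the points \<open>p j\<close>, \<open>\<epsilon> / 4\<close> for replacing \<kappa> x
  by such a point, \<open>\<epsilon> / 4\<close> for replacing orbits of \<open>f'\<close> by orbits
  of \<open>f\<close>, and \<open>\<epsilon> / 8\<close> for the gaps between the flat
  parts.\<close>

lemma CE_perturbation:
  assumes k: "\<bar>k\<bar> \<ge> 2" and f: "f \<in> CE_deg k" and \<mu>: "\<mu> \<in> invariant_probs (apply_bcontfun f)"
    and N: "N > 0" and \<epsilon>: "\<epsilon> > 0" and \<delta>: "\<delta> > 0"
  obtains f' n where "f' \<in> CE_deg k" "dist f' f < \<delta>" "n \<ge> l" "n > 0"
    "\<forall>i<N. \<bar>integral\<^sup>L (avg_pushforward (apply_bcontfun f') n) (bump N i) - integral\<^sup>L \<mu> (bump N i)\<bar> < \<epsilon>"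
proof -
  obtain h where h: "h \<in> Homeo_plus" and fh: "apply_bcontfun f = h \<circ> E_map k \<circ> inv h"
    using f unfolding CE_deg_def by blast
  note hh = Homeo_plusD[OF h]
  have h_inv: "h (inv h x) = x" "inv h (h x) = x" for x
    using hh(1) by (simp_all add: bij_is_inj bij_is_surj surj_f_inv_f)
  define \<phi> where "\<phi> = apply_bcontfun f"
  have \<phi>: "continuous_on UNIV \<phi>" by (simp add: \<phi>_def)
  have \<phi>_pow: "(\<phi> ^^ j) (h z) = h ((E_map k ^^ j) z)" for j z
    unfolding \<phi>_def fh using funpow_conjugate[where g=h and g'="inv h" and f="E_map k"] h_inv by simp
  have \<mu>b: "\<mu> \<in> borel_probs" and \<mu>inv: "distr \<mu> borel \<phi> = \<mu>"
    using \<mu> by (auto simp: invariant_probs_def \<phi>_def)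
  then have \<mu>p: "prob_space \<mu>" and \<mu>s: "sets \<mu> = sets borel" by (auto simp: borel_probs_def)
  define a where "a i = integral\<^sup>L \<mu> (bump N i)" for i
  have bc: "continuous_on UNIV (bump N i)" for i by (rule continuous_bump[OF N])
  have a: "0 \<le> a i" "a i \<le> 1" if "i < N" for i
  proof -
    interpret prob_space \<mu> by (rule \<mu>p)
    show "0 \<le> a i" "a i \<le> 1"
      unfolding a_def using bump_range[OF that] integrable_continuous_circle[OF \<mu>b bc]
      by (auto intro!: Bochner_Integration.integral_nonneg integral_le_const)
  qed

  \<comment> \<open>Orbits are glued for \<open>E_map k\<close>, so the measure and the bumps are
    carried over by the conjugacy; \<open>\<psi>\<close> below is the transported bump.\<close>
  define \<mu>' where "\<mu>' = distr \<mu> borel (inv h)"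
  have ihm: "inv h \<in> \<mu> \<rightarrow>\<^sub>M borel" "inv h \<in> borel \<rightarrow>\<^sub>M borel" "\<phi> \<in> \<mu> \<rightarrow>\<^sub>M borel" "E_map k \<in> borel \<rightarrow>\<^sub>M borel"
    unfolding measurable_cong_sets[OF \<mu>s refl]
    by (intro borel_measurable_continuous_onI hh \<phi> continuous_E_map)+
  have \<mu>': "prob_space \<mu>'" unfolding \<mu>'_def by (rule prob_space.prob_space_distr[OF \<mu>p ihm(1)])
  have "distr \<mu>' borel (E_map k) = distr \<mu> borel (E_map k \<circ> inv h)"
    unfolding \<mu>'_def by (rule distr_distr[OF ihm(4,1)])
  also have "E_map k \<circ> inv h = inv h \<circ> \<phi>" by (auto simp: \<phi>_def fh h_inv fun_eq_iff)
  also have "distr \<mu> borel (inv h \<circ> \<phi>) = distr (distr \<mu> borel \<phi>) borel (inv h)"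
    by (rule distr_distr[OF ihm(2,3), symmetric])
  finally have \<mu>'inv: "distr \<mu>' borel (E_map k) = \<mu>'" by (simp add: \<mu>inv \<mu>'_def)
  define \<psi> where "\<psi> i x = bump N i (h x)" for i x
  have \<psi>c: "continuous_on UNIV (\<psi> i)" for i
    unfolding \<psi>_def by (intro continuous_on_compose2[OF bc hh(2)]) auto
  have \<psi>a: "(\<integral>x. \<psi> i x \<partial>\<mu>') = a i" for i
    unfolding \<mu>'_def a_def using borel_measurable_continuous_onI[OF \<psi>c[of i]]
    by (subst integral_distr[OF ihm(1)]) (simp_all add: \<psi>_def h_inv)

  obtain d1 where d1: "d1 > 0" "\<And>x y. dist x y < d1 \<Longrightarrow> dist (\<phi> x) (\<phi> y) < \<delta> / 2"
    using uniform_continuity_circle[OF \<phi>, of "\<delta> / 2"] \<delta> by auto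
  obtain d2 where d2: "d2 > 0" "\<And>i x y. i < N \<Longrightarrow> dist x y < d2 \<Longrightarrow> dist (bump N i x) (bump N i y) < \<epsilon> / 4"
    using uniform_continuity_circle_finite[of "{..<N}" "bump N" "\<epsilon> / 4"] bc \<epsilon> by auto
  \<comment> \<open>\<open>d1\<close> serves the change of argument by \<open>\<kappa>\<close>,
    \<open>d2\<close> the displacement of orbit points by \<open>g\<close> inside the bumps, and
    \<open>\<delta> / 2\<close> the displacement of the values of the map by
    \<open>g\<close>.\<close>
  define d where "d = min (min d1 d2) (\<delta> / 2)"
  have d: "d > 0" "d \<le> d1" "d \<le> d2" "d \<le> \<delta> / 2" using d1 d2 \<delta> by (auto simp: d_def)
  obtain M' where M': "1 / real (Suc M') < d / 2" using nat_approx_posE[of "d / 2"] d(1) by auto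
  define M where "M = Suc M'"
  have M: "M > 0" "2 / M < d" using M' by (simp_all add: M_def)

  \<comment> \<open>The preimage under \<open>h\<close> of the open arc from \<open>j / M\<close> to
    \<open>(real j + 1) / M\<close>, given as a ball around its midpoint: a point found in it for
    \<open>E_map k\<close> yields one in the arc for \<open>f\<close>.\<close>
  define U where "U j = h -` ball (to_circle ((real j + 1 / 2) / M)) (1 / (2 * M))" for j :: nat
  have U: "open (U j) \<and> U j \<noteq> {}" for j
  proof
    show "open (U j)" unfolding U_def by (intro open_vimage hh) auto
    have "inv h (to_circle ((real j + 1 / 2) / M)) \<in> U j" using M by (simp add: U_def h_inv)
    then show "U j \<noteq> {}" by blast
  qed
  have UU: "open V \<and> V \<noteq> {}" if "V \<in> U ` {..<M}" for V using U that by blast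
  have \<psi>r: "\<psi> i x \<in> {0..1}" if "i \<in> {..<N}" for i x using bump_range[of i N] that by (simp add: \<psi>_def)
  have \<epsilon>4: "\<epsilon> / 4 > 0" using \<epsilon> by simp
  obtain n where n: "n \<ge> l" "n > 0"
    "\<forall>V\<in>U ` {..<M}. \<exists>p\<in>V. \<forall>i\<in>{..<N}. \<bar>(\<Sum>j=1..n. \<psi> i ((E_map k ^^ j) p)) / n - (\<integral>x. \<psi> i x \<partial>\<mu>')\<bar> \<le> \<epsilon> / 4"
    by (rule expanding_orbit_averages[where l=l, OF k \<mu>' \<mu>'inv finite_lessThan \<psi>c \<psi>r \<epsilon>4 finite_imageI[OF finite_lessThan] UU])
  define A where "A i y = (\<Sum>j=1..n. bump N i ((\<phi> ^^ j) y)) / n" for i y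
  have Ac: "continuous_on UNIV (A i)" for i
    unfolding A_def
    by (intro continuous_intros continuous_on_compose2[OF bc continuous_on_funpow[OF \<phi>]]) (use n in auto)
  have "\<exists>y. j / M \<le> y \<and> y \<le> (real j + 1) / M \<and> (\<forall>i<N. \<bar>A i (to_circle y) - a i\<bar> \<le> \<epsilon> / 4)" if j: "j < M" for j
  proof -
    obtain z where z: "z \<in> U j" "\<forall>i\<in>{..<N}. \<bar>(\<Sum>j=1..n. \<psi> i ((E_map k ^^ j) z)) / n - (\<integral>x. \<psi> i x \<partial>\<mu>')\<bar> \<le> \<epsilon> / 4"
      using n(3) j by blast
    have "dist (h z) (to_circle ((real j + 1 / 2) / M)) < 1 / (2 * M)"
      using z(1) by (simp add: U_def dist_commute)
    then obtain y where y: "h z = to_circle y" "dist y ((real j + 1 / 2) / M) < 1 / (2 * M)"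
      by (rule lift_near)
    have e: "(real j + 1 / 2) / M - 1 / (2 * M) = j / M" "(real j + 1 / 2) / M + 1 / (2 * M) = (real j + 1) / M"
      using M(1) by (simp_all add: field_simps)
    have "j / M < y" "y < (real j + 1) / M"
      using y(2) unfolding dist_real_def abs_diff_less_iff e by simp_all
    then have "j / M \<le> y" "y \<le> (real j + 1) / M" by simp_all
    moreover have "\<bar>A i (to_circle y) - a i\<bar> \<le> \<epsilon> / 4" if "i < N" for i
      using z(2) that by (simp add: A_def \<phi>_pow \<psi>_def \<psi>a[unfolded \<psi>_def] flip: y(1))
    ultimately show ?thesis by blast
  qed
  then obtain p where p: "\<And>j. j < M \<Longrightarrow> j / M \<le> p j" "\<And>j. j < M \<Longrightarrow> p j \<le> (real j + 1) / M"
    "\<And>i j. j < M \<Longrightarrow> i < N \<Longrightarrow> \<bar>A i (to_circle (p j)) - a i\<bar> \<le> \<epsilon> / 4" by metis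

  \<comment> \<open>This modulus belongs to averages of \<open>n\<close> iterates and so depends on
    \<open>n\<close>. That is harmless, since \<open>r\<close> does not affect how far
    \<open>K\<close> is from the identity.\<close>
  obtain r where r: "r > 0" "\<And>i x y. i < N \<Longrightarrow> dist x y < r \<Longrightarrow> dist (A i x) (A i y) < \<epsilon> / 4"
    using uniform_continuity_circle_finite[of "{..<N}" A "\<epsilon> / 4"] Ac \<epsilon> by auto
  define \<eta> where "\<eta> = min (1 / (2 * M)) (\<epsilon> / (8 * M))"
  have "1 / (2 * real M) < 1 / M" "1 / (2 * real M) < 1" using M(1) by (simp_all add: field_simps)
  then have \<eta>: "0 < \<eta>" "\<eta> < 1" "\<eta> \<le> 1 / M" "M * \<eta> \<le> \<epsilon> / 8"
    using \<epsilon> M(1) by (auto simp: \<eta>_def min_def field_simps)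
  obtain K where K: "degree_one_lift K" "\<And>x. \<bar>K x - x\<bar> \<le> 2 / M"
    "\<And>j x. j < M \<Longrightarrow> j / M \<le> x \<Longrightarrow> x \<le> (real j + 1) / M - \<eta> \<Longrightarrow> \<bar>K x - p j\<bar> < r"
    using near_identity_lift[OF M(1) p(1,2) r(1) \<eta>(1-3)] by blast
  interpret K: degree_one_lift K by (rule K(1))
  interpret K': degree_one_lift "inv K" by (rule K.degree_one_lift_inv)
  \<comment> \<open>\<open>\<kappa>\<close> contracts most of each arc towards \<open>p j\<close>;
    its inverse \<open>g\<close> is the conjugating homeomorphism.\<close>
  define \<kappa> where "\<kappa> = K.circle_map"
  define g where "g = K'.circle_map"
  have g\<kappa>: "g (\<kappa> x) = x" "\<kappa> (g x) = x" for x
    by (simp_all add: g_def \<kappa>_def K.circle_map_inv_circle_map K.circle_map_circle_map_inv)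
  have inv_g: "inv g = \<kappa>" using g\<kappa> by (intro inv_unique_comp) (auto simp: fun_eq_iff)
  have gH: "g \<in> Homeo_plus" unfolding g_def by (rule K'.circle_map_in_Homeo_plus)
  have dist_\<kappa>: "dist (\<kappa> x) x \<le> 2 / M" for x
    unfolding \<kappa>_def by (rule K.dist_circle_map) (rule K(2))
  have dist_g: "dist (g x) x \<le> 2 / M" for x
    using dist_\<kappa>[of "g x"] by (simp add: g\<kappa> dist_commute)
  define \<phi>' where "\<phi>' = g \<circ> \<phi> \<circ> \<kappa>"
  have \<phi>': "continuous_on UNIV \<phi>'"
    unfolding \<phi>'_def g_def \<kappa>_def
    by (intro continuous_on_compose K.continuous_circle_map continuous_on_subset[OF \<phi>]
        continuous_on_subset[OF K'.continuous_circle_map]) auto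
  define f' where "f' = Bcontfun \<phi>'"
  have f': "apply_bcontfun f' = \<phi>'"
    unfolding f'_def using \<phi>' by (simp add: Bcontfun_inverse bcontfun_circle_iff)
  have "inv (g \<circ> h) = inv h \<circ> inv g"
    using Homeo_plusD(1)[OF gH] hh(1) by (simp add: o_inv_distrib)
  then have "apply_bcontfun f' = (g \<circ> h) \<circ> E_map k \<circ> inv (g \<circ> h)"
    by (simp add: f' \<phi>'_def \<phi>_def fh inv_g comp_assoc)
  then have f'CE: "f' \<in> CE_deg k"
    unfolding CE_deg_def using Homeo_plus_compose[OF gH h] by blast
  have "dist f' f \<le> 2 / M + \<delta> / 2"
  proof (rule dist_bound)
    fix x
    have "dist (\<phi> (\<kappa> x)) (\<phi> x) < \<delta> / 2" using dist_\<kappa>[of x] M d by (intro d1) linarith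
    then show "dist (apply_bcontfun f' x) (apply_bcontfun f x) \<le> 2 / M + \<delta> / 2"
      using dist_triangle[of "g (\<phi> (\<kappa> x))" "\<phi> x" "\<phi> (\<kappa> x)"] dist_g[of "\<phi> (\<kappa> x)"]
      unfolding f' \<phi>'_def \<phi>_def[symmetric] comp_apply by linarith
  qed
  then have dist_f': "dist f' f < \<delta>" using M d by linarith
  have \<phi>'_pow: "(\<phi>' ^^ j) x = g ((\<phi> ^^ j) (\<kappa> x))" for j x
    unfolding \<phi>'_def using funpow_conjugate[where g=g and g'=\<kappa> and f=\<phi>] g\<kappa> by simp
  define A' where "A' i y = (\<Sum>j=1..n. bump N i ((\<phi>' ^^ j) y)) / n" for i y
  have A'c: "continuous_on UNIV (A' i)" for i
    unfolding A'_def
    by (intro continuous_intros continuous_on_compose2[OF bc continuous_on_funpow[OF \<phi>']]) (use n in auto)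
  have A'_range: "0 \<le> A' i y" "A' i y \<le> 1" if "i < N" for i y
  proof -
    show "0 \<le> A' i y" unfolding A'_def by (intro divide_nonneg_nonneg sum_nonneg bump_nonneg) auto
    have "(\<Sum>j=1..n. bump N i ((\<phi>' ^^ j) y)) \<le> n"
      using sum_bounded_above[of "{1..n}" "\<lambda>j. bump N i ((\<phi>' ^^ j) y)" 1] bump_range[OF that] by auto
    then show "A' i y \<le> 1" using n unfolding A'_def by simp
  qed
  \<comment> \<open>Orbits of \<open>\<phi>'\<close> are \<open>g\<close>-images of orbits of
    \<open>\<phi>\<close> started at \<open>\<kappa> y\<close>, so they stay within
    \<open>2 / M\<close> of these for all times, however large \<open>n\<close> is.\<close>
  have A'_near: "\<bar>A' i y - A i (\<kappa> y)\<bar> \<le> \<epsilon> / 4" if i: "i < N" for i y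
  proof -
    have "\<bar>bump N i ((\<phi>' ^^ j) y) - bump N i ((\<phi> ^^ j) (\<kappa> y))\<bar> \<le> \<epsilon> / 4" for j
    proof -
      have "dist (g ((\<phi> ^^ j) (\<kappa> y))) ((\<phi> ^^ j) (\<kappa> y)) < d2" using dist_g[of "(\<phi> ^^ j) (\<kappa> y)"] M d by linarith
      from d2(2)[OF i this] show ?thesis by (simp add: \<phi>'_pow dist_real_def)
    qed
    then have "(\<Sum>j=1..n. \<bar>bump N i ((\<phi>' ^^ j) y) - bump N i ((\<phi> ^^ j) (\<kappa> y))\<bar>) \<le> n * (\<epsilon> / 4)"
      using sum_bounded_above[of "{1..n}" "\<lambda>j. \<bar>bump N i ((\<phi>' ^^ j) y) - bump N i ((\<phi> ^^ j) (\<kappa> y))\<bar>" "\<epsilon> / 4"] by simp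
    then have "\<bar>(\<Sum>j=1..n. bump N i ((\<phi>' ^^ j) y) - bump N i ((\<phi> ^^ j) (\<kappa> y)))\<bar> \<le> n * (\<epsilon> / 4)"
      by (rule order_trans[OF sum_abs])
    then have "\<bar>(\<Sum>j=1..n. bump N i ((\<phi>' ^^ j) y) - bump N i ((\<phi> ^^ j) (\<kappa> y)))\<bar> / n \<le> \<epsilon> / 4"
      using n by (simp add: divide_le_eq mult.commute)
    then show ?thesis by (simp add: A'_def A_def sum_subtractf flip: diff_divide_distrib)
  qed
  have "\<bar>integral\<^sup>L (avg_pushforward \<phi>' n) (bump N i) - a i\<bar> < \<epsilon>" if i: "i < N" for i
  proof -
    have "integrable Lebesgue_circle (\<lambda>x. bump N i ((\<phi>' ^^ j) x))" for j
      by (intro integrable_continuous_circle Lebesgue_circle_in_borel_probs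
          continuous_on_compose2[OF bc continuous_on_funpow[OF \<phi>']]) auto
    then have "integral\<^sup>L (avg_pushforward \<phi>' n) (bump N i) = (\<integral>x. A' i x \<partial>Lebesgue_circle)"
      by (simp add: integral_avg_pushforward[OF \<phi>' n(2) bc] A'_def Bochner_Integration.integral_sum)
    moreover have "\<bar>(\<integral>x. A' i x \<partial>Lebesgue_circle) - a i\<bar> \<le> 3 * \<epsilon> / 4 + M * \<eta>"
    proof (rule Lebesgue_circle_integral_near[OF A'c M(1) \<eta>(1,3)])
      show "0 \<le> 3 * \<epsilon> / 4" using \<epsilon> by simp
      show "\<bar>A' i x - a i\<bar> \<le> 1" for x using A'_range[OF i, of x] a[OF i] by (simp add: abs_le_iff)
      fix j x assume jx: "j < M" "j / M \<le> x" "x \<le> (real j + 1) / M - \<eta>"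
      have "dist (\<kappa> (to_circle x)) (to_circle (p j)) < r"
        using dist_to_circle_le[of "K x" "p j"] K(3)[OF jx]
        by (simp add: \<kappa>_def K.circle_map_to_circle dist_real_def)
      from r(2)[OF i this] show "\<bar>A' i (to_circle x) - a i\<bar> \<le> 3 * \<epsilon> / 4"
        using A'_near[OF i, of "to_circle x"] p(3)[OF jx(1) i] unfolding dist_real_def by linarith
    qed
    ultimately show ?thesis using \<eta>(4) \<epsilon> by linarith
  qed
  then show ?thesis using that[OF f'CE dist_f' n(1,2)] by (simp add: f' a_def)
qed

section \<open>Generic maps are wicked\<close>

text \<open>A permutation of a finite set preserves its uniform distribution. Pushing forward by
  \<open>id\<close> restricts the measure from all subsets to the Borel sets.\<close>

lemma uniform_measure_invariant:
  fixes f :: "circle \<Rightarrow> circle"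
  assumes f: "continuous_on UNIV f" and S: "finite S" "S \<noteq> {}" "inj_on f S" "f ` S = S"
  shows "distr (measure_pmf (pmf_of_set S)) borel id \<in> invariant_probs f"
proof -
  define p where "p = pmf_of_set S"
  have fm: "f \<in> borel \<rightarrow>\<^sub>M borel" using f by (rule borel_measurable_continuous_onI)
  have idm: "id \<in> measure_pmf p \<rightarrow>\<^sub>M borel" "id \<in> count_space UNIV \<rightarrow>\<^sub>M borel" by simp_all
  have "distr (distr (measure_pmf p) borel id) borel f = distr (measure_pmf p) borel (f \<circ> id)"
    by (rule distr_distr[OF fm idm(1)])
  also have "\<dots> = distr (measure_pmf p) borel (id \<circ> f)" by simp
  also have "\<dots> = distr (distr (measure_pmf p) (count_space UNIV) f) borel id"
    by (rule distr_distr[symmetric, OF idm(2)]) simp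
  also have "distr (measure_pmf p) (count_space UNIV) f = measure_pmf (map_pmf f p)"
    by (rule map_pmf_rep_eq[symmetric])
  also have "map_pmf f p = p" unfolding p_def using map_pmf_of_set_inj[OF S(3,2,1)] S(4) by simp
  finally have "distr (distr (measure_pmf p) borel id) borel f = distr (measure_pmf p) borel id" .
  then show ?thesis
    unfolding invariant_probs_def borel_probs_def p_def[symmetric] mem_Collect_eq
    by (intro conjI prob_space.prob_space_distr[OF prob_space_measure_pmf idm(1)]) simp_all
qed

lemma emeasure_uniform_measure:
  fixes y :: circle
  assumes "finite S" "S \<noteq> {}"
  shows "emeasure (distr (measure_pmf (pmf_of_set S)) borel id) {y} = indicator S y / card S"
  using assms by (subst emeasure_distr) (auto simp: emeasure_pmf_single pmf_of_set indicator_def divide_ennreal)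

text \<open>The orbit of \<open>1 / (k\<^sup>2 - 1)\<close> under \<open>E_map k\<close> has period at most two and avoids the fixed point \<open>0\<close>.\<close>

lemma CE_not_uniquely_ergodic:
  assumes k: "\<bar>k\<bar> \<ge> 2" and f: "f \<in> CE_deg k"
  shows "\<not> uniquely_ergodic (apply_bcontfun f)"
proof
  assume ue: "uniquely_ergodic (apply_bcontfun f)"
  obtain h where h: "h \<in> Homeo_plus" and fh: "apply_bcontfun f = h \<circ> E_map k \<circ> inv h"
    using f unfolding CE_deg_def by blast
  have inj: "inj h" using Homeo_plusD(1)[OF h] by (rule bij_is_inj)
  then have f_h: "apply_bcontfun f (h z) = h (E_map k z)" for z by (simp add: fh)
  have fc: "continuous_on UNIV (apply_bcontfun f)" by simp
  define c where "c = to_circle 0"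
  \<comment> \<open>For \<open>k = 2\<close> the point 0 is the only fixed point, hence the recourse
    to a point of period two.\<close>
  define p where "p = to_circle (1 / (of_int k ^ 2 - 1))"
  define q where "q = E_map k p"
  have "(2::real) \<le> \<bar>of_int k\<bar>" using k by linarith
  then have "(2::real)^2 \<le> \<bar>of_int k\<bar>^2" by (intro power_mono) auto
  then have k2: "(4::real) \<le> of_int k ^ 2" by simp
  have Ec: "E_map k c = c" by (simp add: c_def E_map_to_circle)
  have "of_int k * (of_int k * (1 / (of_int k ^ 2 - 1))) - 1 / (of_int k ^ 2 - 1)
      = (of_int k ^ 2 - 1) * (1 / (of_int k ^ 2 - 1) :: real)"
    by (simp only: left_diff_distrib power2_eq_square mult_1 mult.assoc)
  also have "\<dots> = 1" using k2 by simp
  finally have "of_int k * (of_int k * (1 / (of_int k ^ 2 - 1))) - 1 / (of_int k ^ 2 - 1) = (1::real)" .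
  then have Eq: "E_map k q = p"
    by (simp add: q_def p_def E_map_to_circle to_circle_eq_iff)
  have "1 / (of_int k ^ 2 - 1) \<notin> (\<int> :: real set)"
  proof
    assume "1 / (of_int k ^ 2 - 1) \<in> (\<int> :: real set)"
    then obtain m where m: "1 / (of_int k ^ 2 - 1) = real_of_int m" by (auto elim: Ints_cases)
    have "0 < 1 / (of_int k ^ 2 - 1 :: real)" "1 / (of_int k ^ 2 - 1 :: real) < 1" using k2 by simp_all
    then have "0 < m" "m < 1" unfolding m by simp_all
    then show False by simp
  qed
  then have pc: "p \<noteq> c" by (simp add: p_def c_def to_circle_eq_iff)
  then have qc: "q \<noteq> c" using Ec Eq by metis
  have "distr (measure_pmf (pmf_of_set {h c})) borel id \<in> invariant_probs (apply_bcontfun f)"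
    by (intro uniform_measure_invariant fc) (auto simp: f_h Ec)
  \<comment> \<open>For \<open>k = -2\<close> the points \<open>p\<close> and \<open>q\<close>
    coincide; written as a set, their orbit covers this case too.\<close>
  moreover have "distr (measure_pmf (pmf_of_set {h p, h q})) borel id \<in> invariant_probs (apply_bcontfun f)"
    using Eq by (intro uniform_measure_invariant fc) (auto simp: f_h q_def[symmetric] inj_on_def)
  ultimately have "distr (measure_pmf (pmf_of_set {h c})) borel id
      = distr (measure_pmf (pmf_of_set {h p, h q})) borel id"
    using ue unfolding uniquely_ergodic_def by blast
  then have eq: "emeasure (distr (measure_pmf (pmf_of_set {h c})) borel id) {h c}
      = emeasure (distr (measure_pmf (pmf_of_set {h p, h q})) borel id) {h c}"
    by (rule arg_cong)
  have "h c \<notin> {h p, h q}" using pc qc inj by (auto dest: injD)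
  then show False
    using eq emeasure_uniform_measure[of "{h c}" "h c"] emeasure_uniform_measure[of "{h p, h q}" "h c"] by simp
qed

text \<open>Half of \<open>\<eta>\<close> is spent on the distance from the target to the integrals
  against \<open>\<mu>\<close>, the other half on \<open>CE_perturbation\<close>, whose map has the
  same degree and so stays in \<open>CE\<close>.\<close>

lemma CE_closure_bump_target:
  assumes f: "f \<in> CE" and \<mu>: "\<mu> \<in> invariant_probs (apply_bcontfun f)"
    and r: "\<And>i. i < N \<Longrightarrow> \<bar>integral\<^sup>L \<mu> (bump N i) - r i\<bar> < \<eta> / 2" and N: "N > 0" and \<eta>: "\<eta> > 0"
  shows "f \<in> top_of_set CE closure_of bump_target N r l \<eta>"
  unfolding in_closure_of
proof (intro conjI allI impI)
  show "f \<in> topspace (top_of_set CE)" using f by simp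
  fix T assume T: "f \<in> T \<and> openin (top_of_set CE) T"
  then obtain \<delta> where \<delta>: "\<delta> > 0" "\<And>f'. f' \<in> CE \<Longrightarrow> dist f' f < \<delta> \<Longrightarrow> f' \<in> T"
    unfolding openin_euclidean_subtopology_iff by blast
  obtain k where k: "\<bar>k\<bar> \<ge> 2" "f \<in> CE_deg k" using f by (auto simp: CE_def)
  have "\<eta> / 2 > 0" using \<eta> by simp
  then obtain f' n where f': "f' \<in> CE_deg k" "dist f' f < \<delta>" "n \<ge> l" "n > 0"
    "\<forall>i<N. \<bar>integral\<^sup>L (avg_pushforward (apply_bcontfun f') n) (bump N i) - integral\<^sup>L \<mu> (bump N i)\<bar> < \<eta> / 2"
    by (rule CE_perturbation[where l=l, OF k \<mu> N _ \<delta>(1)])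
  have CE: "f' \<in> CE" using k(1) f'(1) by (auto simp: CE_def)
  have "\<bar>integral\<^sup>L (avg_pushforward (apply_bcontfun f') n) (bump N i) - r i\<bar> < \<eta>" if "i < N" for i
    using f'(5)[rule_format, OF that] r[OF that] by linarith
  then have "f' \<in> bump_target N r l \<eta>" using CE f'(3,4) unfolding bump_target_def by blast
  then show "\<exists>y. y \<in> bump_target N r l \<eta> \<and> y \<in> T" using \<delta>(2)[OF CE f'(2)] by blast
qed

theorem theorem3p10:
  shows "\<exists>R. residual_in (subtopology euclidean CE) R \<and> (\<forall>f\<in>R. wicked (apply_bcontfun f))"
proof -
  define X where "X = top_of_set CE"
  \<comment> \<open>The index is a tuple of naturals and a list of rationals, thus from a countable
    type; \<open>1 / real (Suc q)\<close> provides arbitrarily small radii.\<close>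
  define B where "B = (\<lambda>(N, rs, l, q). bump_target N (\<lambda>i. real_of_rat (rs ! i)) l (1 / real (Suc q)))"
  define V where "V t = B t \<union> (topspace X - X closure_of B t)" for t
  define R where "R = topspace X \<inter> \<Inter>(range V)"
  have "openin X (B t)" for t
    by (cases t) (simp add: B_def X_def openin_bump_target)
  then have "openin X (V t)" "X closure_of (V t) = topspace X" for t
    unfolding V_def using open_dense_splitting by blast+
  moreover have "countable (range V)" by simp
  ultimately have "residual_in X R"
    unfolding residual_in_def R_def by (intro conjI exI[of _ "range V"]) auto
  moreover have "wicked (apply_bcontfun f)" if f: "f \<in> R" for f
  proof -
    have fCE: "f \<in> CE" using f by (simp add: R_def X_def)
    then obtain k where k: "\<bar>k\<bar> \<ge> 2" "f \<in> CE_deg k" by (auto simp: CE_def)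
    have fc: "continuous_on UNIV (apply_bcontfun f)" by simp
    have "\<mu> \<in> weak_star closure_of {avg_pushforward (apply_bcontfun f) k |k. k \<ge> n}"
      if \<mu>: "\<mu> \<in> invariant_probs (apply_bcontfun f)" and n: "n \<ge> 1" for \<mu> n
    proof (rule weak_star_closure_bumpI)
      show "\<mu> \<in> borel_probs" using \<mu> by (simp add: invariant_probs_def)
      show "{avg_pushforward (apply_bcontfun f) k |k. k \<ge> n} \<subseteq> borel_probs"
        using n avg_pushforward_in_borel_probs[OF fc] by auto
      fix N :: nat and \<epsilon> :: real assume N: "N > 0" and \<epsilon>: "\<epsilon> > 0"
      \<comment> \<open>The radius \<open>\<eta>\<close> is below \<open>\<epsilon> / 2\<close>: the
        target is within \<open>\<eta> / 2\<close> of the integrals against \<open>\<mu>\<close> and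
        within \<open>\<eta>\<close> of those against the average, in total less than
        \<open>\<epsilon>\<close>.\<close>
      obtain q where q: "1 / real (Suc q) < \<epsilon> / 2" using nat_approx_posE[of "\<epsilon> / 2"] \<epsilon> by auto
      define \<eta> where "\<eta> = 1 / real (Suc q)"
      have \<eta>: "\<eta> > 0" by (simp add: \<eta>_def)
      have "\<exists>r. \<bar>integral\<^sup>L \<mu> (bump N i) - real_of_rat r\<bar> < \<eta> / 2" for i
      proof -
        obtain r where "integral\<^sup>L \<mu> (bump N i) - \<eta> / 2 < real_of_rat r" "real_of_rat r < integral\<^sup>L \<mu> (bump N i) + \<eta> / 2"
          using of_rat_dense[of "integral\<^sup>L \<mu> (bump N i) - \<eta> / 2" "integral\<^sup>L \<mu> (bump N i) + \<eta> / 2"] \<eta> by auto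
        then have "\<bar>integral\<^sup>L \<mu> (bump N i) - real_of_rat r\<bar> < \<eta> / 2" by linarith
        then show ?thesis by blast
      qed
      then obtain r where r: "\<And>i. \<bar>integral\<^sup>L \<mu> (bump N i) - real_of_rat (r i)\<bar> < \<eta> / 2" by metis
      define rs where "rs = map r [0..<N]"
      have rs: "\<bar>integral\<^sup>L \<mu> (bump N i) - real_of_rat (rs ! i)\<bar> < \<eta> / 2" if "i < N" for i
        using r[of i] that by (simp add: rs_def)
      have "f \<in> X closure_of B (N, rs, n, q)"
        using CE_closure_bump_target[OF fCE \<mu> rs N \<eta>, of n] by (simp add: X_def B_def \<eta>_def)
      moreover have "f \<in> V (N, rs, n, q)" using f by (simp add: R_def)
      ultimately have "f \<in> B (N, rs, n, q)" by (simp add: V_def)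
      then obtain k where k: "k \<ge> n" "\<forall>i<N. \<bar>integral\<^sup>L (avg_pushforward (apply_bcontfun f) k) (bump N i) - real_of_rat (rs ! i)\<bar> < \<eta>"
        by (auto simp: B_def bump_target_def \<eta>_def)
      have "\<bar>integral\<^sup>L (avg_pushforward (apply_bcontfun f) k) (bump N i) - integral\<^sup>L \<mu> (bump N i)\<bar> < \<epsilon>" if "i < N" for i
        using k(2)[rule_format, OF that] rs[OF that] q \<eta> unfolding \<eta>_def[symmetric] by linarith
      then show "\<exists>\<nu>\<in>{avg_pushforward (apply_bcontfun f) k |k. k \<ge> n}.
          \<forall>i<N. \<bar>integral\<^sup>L \<nu> (bump N i) - integral\<^sup>L \<mu> (bump N i)\<bar> < \<epsilon>"
        using k(1) by blast
    qed
    then have "invariant_probs (apply_bcontfun f) =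
        (\<Inter>n\<in>{1..}. weak_star closure_of {avg_pushforward (apply_bcontfun f) k |k. k \<ge> n})"
      using weak_star_limit_invariant[OF fc] by auto
    then show ?thesis
      unfolding wicked_def using CE_not_uniquely_ergodic[OF k] by blast
  qed
  ultimately show ?thesis unfolding X_def by blast
qed

end
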